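(* Assume the following. (a) For every $i$: with probability $1$, $M_i(t_2,X_i)-M_i(t_1,X_i)=\int_{t_1}^{t_2}M_i'(t,X_i)\,dt$ for all intervals $(t_1,t_2)\subset\Theta$ (with endpoints in $\Theta$); moreover $\mathbf{E}M_i(\theta,X_i)=0$, $\mathbf{E}M_i^2(\theta,X_i)<\infty$, $\mathbf{E}|M_i'(\theta,X_i)|<\infty$. (b) For all sufficiently large $n$, $I_n>0$ and $J_n\neq 0$; moreover $|J_n|/\sqrt{I_n}\to\infty$, $\sum_{i=1}^n M_i'(\theta,X_i)/J_n\xrightarrow{p}1$ and $\sum_{i=1}^n M_i(\theta,X_i)/\sqrt{I_n}\Rightarrow\mathcal{N}(0,1)$. (c) $\lim_{\delta\to0}\limsup_{n\to\infty}\overline\tau_n(\delta)=0$. (d) The estimator $\theta_n^*=\theta_n^*(X_1,\dots,X_n)$ satisfies $\frac{|J_n|}{\sqrt{I_n}}|\theta_n^*-\theta|\,\overline\tau_n(|\theta_n^*-\theta|)\xrightarrow{p}0$. Then the one-step $M$-estimator $$\theta_{n,M}^{**}=\theta_n^*-\frac{\sum_{i=1}^n M_i(\theta_n^*,X_i)}{\sum_{i=1}^n M_i'(\theta_n^*,X_i)}$$ is defined with probability tending to $1$, and $$\Delta_{n,M}:=\frac{J_n}{\sqrt{I_n}}\big(\theta_{n,M}^{**}-\theta\big)+\frac{1}{\sqrt{I_n}}\sum_{i=1}^nM_i(\theta,X_i)\xrightarrow{p}0.$$ In particular, $\frac{J_n}{\sqrt{I_n}}\big(\theta_{n,M}^{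**}-\theta\big)\Rightarrow\mathcal{N}(0,1)$.
   Context: All limits are as $n\to\infty$ unless stated otherwise; $\xrightarrow{p}$ is convergence in probability, $\Rightarrow$ is weak convergence of distributions. Setting: for each $n$ one observes independent elements $X_1,\dots,X_n$ of an arbitrary measurable space, not necessarily identically distributed. Their distributions depend on an unknown parameter belonging to an open set $\Theta\subset\mathbb{R}$, may also depend on $n$, and may depend on nuisance parameters. The symbol $\theta\in\Theta$ denotes the (fixed) true value, and $\mathbf{P},\mathbf{E}$ refer to the true distributions. For each $i$ there are given functions $M_i(t,X_i)$ and $M_i'(t,X_i)$ of $t\in\Theta$ (possibly depending on $n$). Notation: $I_n=\sum_{i=1}^n\mathbf{E}M_i^2(\theta,X_i)$, $J_n=\sum_{i=1}^n\mathbf{E}M_i'(\theta,X_i)$, $\overline\tau_n(\delta)=|J_n|^{-1}\sum_{i=1}^n\mathbf{E}\tau_i(\delta,X_i)$, where $\tau_i(\delta,X_i)=\sup_{t:|t-\theta|\le\delta}|M_i'(t,X_i)-M_i'(\theta,X_i)|$ if $[\theta-\delta,\theta+\delta]\subset\Theta$ and $\tau_i(\delta,X_i)=\infty$ otherwise. In $\overline\tau_n(|\theta_n^*-\theta|)$ the deterministic function $\overline\tau_n$ is evaluated at the random point $|\theta_n^*-\theta|$. A statistic is "defined with probability tending to $1$" if the probability that all quantities in its definition are defined (here $\theta_n^*\in\Theta$ and the denominator is nonzero) tends to $1$. *)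

theory Defs
  imports "HOL-Probability.Probability"
begin

text \<open>
  Throughout, \<open>P n\<close> is the true probability measure of the \<open>n\<close>-th experiment, \<open>X n i\<close> is its \<open>i\<close>-th
  observation (\<open>1 \<le> i \<le> n\<close>), and \<open>M n i t x\<close>, \<open>M' n i t x\<close> are the given functions, of which only
  the values at \<open>t \<in> \<Theta>\<close> are meaningful.
\<close>

definition tends_in_prob ::
  "(nat \<Rightarrow> 'w measure) \<Rightarrow> (nat \<Rightarrow> 'w \<Rightarrow> real) \<Rightarrow> real \<Rightarrow> bool" where
  "tends_in_prob P Y c \<longleftrightarrow>
     (\<forall>\<epsilon>>0. (\<lambda>n. measure (P n) {\<omega> \<in> space (P n). \<bar>Y n \<omega> - c\<bar> > \<epsilon>}) \<longlonglongrightarrow> 0)"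

text \<open>The same for \<open>[0,\<infinity>]\<close>-valued variables and the limit \<open>0\<close>.\<close>

definition tends_in_prob_0 ::
  "(nat \<Rightarrow> 'w measure) \<Rightarrow> (nat \<Rightarrow> 'w \<Rightarrow> ennreal) \<Rightarrow> bool" where
  "tends_in_prob_0 P Y \<longleftrightarrow>
     (\<forall>\<epsilon>::real. \<epsilon> > 0 \<longrightarrow>
        (\<lambda>n. measure (P n) {\<omega> \<in> space (P n). Y n \<omega> > ennreal \<epsilon>}) \<longlonglongrightarrow> 0)"

definition I_sum ::
  "(nat \<Rightarrow> 'w measure) \<Rightarrow> (nat \<Rightarrow> nat \<Rightarrow> 'w \<Rightarrow> 'a) \<Rightarrow> (nat \<Rightarrow> nat \<Rightarrow> real \<Rightarrow> 'a \<Rightarrow> real)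
     \<Rightarrow> real \<Rightarrow> nat \<Rightarrow> real" where
  "I_sum P X M \<theta> n = (\<Sum>i=1..n. LINT \<omega>|P n. (M n i \<theta> (X n i \<omega>))\<^sup>2)"

definition J_sum ::
  "(nat \<Rightarrow> 'w measure) \<Rightarrow> (nat \<Rightarrow> nat \<Rightarrow> 'w \<Rightarrow> 'a) \<Rightarrow> (nat \<Rightarrow> nat \<Rightarrow> real \<Rightarrow> 'a \<Rightarrow> real)
     \<Rightarrow> real \<Rightarrow> nat \<Rightarrow> real" where
  "J_sum P X M' \<theta> n = (\<Sum>i=1..n. LINT \<omega>|P n. M' n i \<theta> (X n i \<omega>))"

text \<open>Here \<open>g t x\<close> stands for \<open>M' n i t x\<close>. The value at \<open>\<delta> = 0\<close> is \<open>0\<close> if \<open>\<theta> \<in> \<Theta>\<close>.\<close>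

definition tau ::
  "real set \<Rightarrow> real \<Rightarrow> (real \<Rightarrow> 'a \<Rightarrow> real) \<Rightarrow> real \<Rightarrow> 'a \<Rightarrow> ennreal" where
  "tau \<Theta> \<theta> g \<delta> x =
     (if {\<theta> - \<delta>..\<theta> + \<delta>} \<subseteq> \<Theta>
      then (SUP t\<in>{t. \<bar>t - \<theta>\<bar> \<le> \<delta>}. ennreal \<bar>g t x - g \<theta> x\<bar>)
      else \<infinity>)"

definition tau_bar ::
  "(nat \<Rightarrow> 'w measure) \<Rightarrow> (nat \<Rightarrow> nat \<Rightarrow> 'w \<Rightarrow> 'a) \<Rightarrow> real set
     \<Rightarrow> (nat \<Rightarrow> nat \<Rightarrow> real \<Rightarrow> 'a \<Rightarrow> real) \<Rightarrow> real \<Rightarrow> nat \<Rightarrow> real \<Rightarrow> ennreal" where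
  "tau_bar P X \<Theta> M' \<theta> n \<delta> =
     (\<Sum>i=1..n. \<integral>\<^sup>+ \<omega>. tau \<Theta> \<theta> (M' n i) \<delta> (X n i \<omega>) \<partial>P n) / ennreal \<bar>J_sum P X M' \<theta> n\<bar>"

text \<open>An estimator is a function \<open>T n\<close> of the sample \<open>(X n 1, \<dots>, X n n)\<close>.\<close>

definition estimate ::
  "(nat \<Rightarrow> nat \<Rightarrow> 'w \<Rightarrow> 'a) \<Rightarrow> (nat \<Rightarrow> (nat \<Rightarrow> 'a) \<Rightarrow> real) \<Rightarrow> nat \<Rightarrow> 'w \<Rightarrow> real" where
  "estimate X T n \<omega> = T n (\<lambda>i\<in>{1..n}. X n i \<omega>)"

text \<open>The one-step estimator started at \<open>S\<close>. The formula is meaningful only where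
  \<open>one_step_defined\<close> holds.\<close>

definition one_step ::
  "(nat \<Rightarrow> nat \<Rightarrow> 'w \<Rightarrow> 'a) \<Rightarrow> (nat \<Rightarrow> nat \<Rightarrow> real \<Rightarrow> 'a \<Rightarrow> real)
     \<Rightarrow> (nat \<Rightarrow> nat \<Rightarrow> real \<Rightarrow> 'a \<Rightarrow> real) \<Rightarrow> (nat \<Rightarrow> 'w \<Rightarrow> real) \<Rightarrow> nat \<Rightarrow> 'w \<Rightarrow> real" where
  "one_step X M M' S n \<omega> =
     S n \<omega> - (\<Sum>i=1..n. M n i (S n \<omega>) (X n i \<omega>)) / (\<Sum>i=1..n. M' n i (S n \<omega>) (X n i \<omega>))"

definition one_step_defined ::
  "real set \<Rightarrow> (nat \<Rightarrow> nat \<Rightarrow> 'w \<Rightarrow> 'a) \<Rightarrow> (nat \<Rightarrow> nat \<Rightarrow> real \<Rightarrow> 'a \<Rightarrow> real)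
     \<Rightarrow> (nat \<Rightarrow> 'w \<Rightarrow> real) \<Rightarrow> nat \<Rightarrow> 'w \<Rightarrow> bool" where
  "one_step_defined \<Theta> X M' S n \<omega> \<longleftrightarrow>
     S n \<omega> \<in> \<Theta> \<and> (\<Sum>i=1..n. M' n i (S n \<omega>) (X n i \<omega>)) \<noteq> 0"

text \<open>
  A partially defined statistic is handled through its total versions: \<open>V\<close> is a sequence of random
  variables that agree with the one-step estimator wherever the latter is defined and take arbitrary
  values elsewhere.
\<close>

definition one_step_version ::
  "(nat \<Rightarrow> 'w measure) \<Rightarrow> real set \<Rightarrow> (nat \<Rightarrow> nat \<Rightarrow> 'w \<Rightarrow> 'a)
     \<Rightarrow> (nat \<Rightarrow> nat \<Rightarrow> real \<Rightarrow> 'a \<Rightarrow> real) \<Rightarrow> (nat \<Rightarrow> nat \<Rightarrow> real \<Rightarrow> 'a \<Rightarrow> real)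
     \<Rightarrow> (nat \<Rightarrow> 'w \<Rightarrow> real) \<Rightarrow> (nat \<Rightarrow> 'w \<Rightarrow> real) \<Rightarrow> bool" where
  "one_step_version P \<Theta> X M M' S V \<longleftrightarrow>
     (\<forall>n. V n \<in> borel_measurable (P n) \<and>
          (\<forall>\<omega>\<in>space (P n). one_step_defined \<Theta> X M' S n \<omega> \<longrightarrow> V n \<omega> = one_step X M M' S n \<omega>))"

end

theory Submission
  imports Defs
begin

text \<open>
  Put \<open>h = \<theta>\<^sup>*\<^sub>n - \<theta>\<close>, let \<open>A\<close> and \<open>B\<close> be the sums of \<open>M'\<^sub>i\<close> at \<open>\<theta>\<^sup>*\<^sub>n\<close> and at \<open>\<theta>\<close>, \<open>C\<close> and \<open>E\<close> those of \<open>M\<^sub>i\<close>, and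
  \<open>T(\<delta>) = (\<Sum>i. \<tau>\<^sub>i(\<delta>, X\<^sub>i)) / \<bar>J\<bar>\<close>. With \<open>a = A / J\<close>,
  \<open>\<Delta> = (h (A - B) - (C - E - h B) + (a - 1) E) / (a \<surd>I)\<close>, where the first two terms are at most
  \<open>\<bar>J\<bar> \<bar>h\<bar> T(\<bar>h\<bar>)\<close> and \<open>\<bar>a - 1\<bar> \<le> \<bar>B / J - 1\<bar> + T(\<bar>h\<bar>)\<close>; since \<open>E / \<surd>I\<close> is bounded in probability, it remains
  to control \<open>T\<close> at the random point \<open>\<bar>h\<bar>\<close>. As \<open>\<delta> \<mapsto> \<delta> T(\<delta>)\<close> is monotone with mean
  \<open>\<delta> \<tau>\<^sub>n(\<delta>)\<close>, the points where the scaled mean is at most \<open>\<epsilon>\<close> form an interval, and Markov's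
  inequality holds simultaneously on this interval; so (d) gives \<open>\<bar>J\<bar> \<bar>h\<bar> T(\<bar>h\<bar>) / \<surd>I \<rightarrow> 0\<close>. Finally
  \<open>T(\<bar>h\<bar>) \<rightarrow> 0\<close>, by (c) where \<open>\<bar>h\<bar> \<le> \<delta>\<close>, and by \<open>\<bar>J\<bar> / \<surd>I \<rightarrow> \<infinity>\<close> where \<open>\<bar>h\<bar> > \<delta>\<close>.
\<close>

subsection \<open>Events of probability tending to one\<close>

text \<open>The events \<open>A n\<close> need not be measurable: \<open>\<tau>\<^sub>i\<close> evaluated at a random point is a
  supremum over an uncountable random set. Hence the measurable exceptional sets.\<close>

definition whp :: "(nat \<Rightarrow> 'w measure) \<Rightarrow> (nat \<Rightarrow> 'w \<Rightarrow> bool) \<Rightarrow> bool" where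
  "whp P A \<longleftrightarrow>
     (\<forall>\<alpha>>0. \<forall>\<^sub>F n in sequentially.
        \<exists>N\<in>sets (P n). measure (P n) N \<le> \<alpha> \<and> (\<forall>\<omega>\<in>space (P n) - N. A n \<omega>))"

lemma whpI:
  assumes "\<And>\<alpha>. \<alpha> > 0 \<Longrightarrow> \<forall>\<^sub>F n in sequentially.
             \<exists>N\<in>sets (P n). measure (P n) N \<le> \<alpha> \<and> (\<forall>\<omega>\<in>space (P n) - N. A n \<omega>)"
  shows "whp P A"
  using assms by (simp add: whp_def)

lemma whp_conj:
  assumes prob: "\<And>n. prob_space (P n)" and "whp P A" "whp P B"
  shows "whp P (\<lambda>n \<omega>. A n \<omega> \<and> B n \<omega>)"
proof (rule whpI)
  fix \<alpha> :: real assume "\<alpha> > 0"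
  then have "\<alpha>/2 > 0" by simp
  with assms(2,3) have
    "\<forall>\<^sub>F n in sequentially. \<exists>N\<in>sets (P n). measure (P n) N \<le> \<alpha>/2 \<and> (\<forall>\<omega>\<in>space (P n) - N. A n \<omega>)"
    "\<forall>\<^sub>F n in sequentially. \<exists>N\<in>sets (P n). measure (P n) N \<le> \<alpha>/2 \<and> (\<forall>\<omega>\<in>space (P n) - N. B n \<omega>)"
    unfolding whp_def by blast+
  then show "\<forall>\<^sub>F n in sequentially. \<exists>N\<in>sets (P n).
               measure (P n) N \<le> \<alpha> \<and> (\<forall>\<omega>\<in>space (P n) - N. A n \<omega> \<and> B n \<omega>)"
  proof eventually_elim
    case (elim n)
    interpret prob_space "P n" by (rule prob)
    obtain N1 N2 where N: "N1 \<in> sets (P n)" "N2 \<in> sets (P n)"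
        "measure (P n) N1 \<le> \<alpha>/2" "measure (P n) N2 \<le> \<alpha>/2"
        "\<forall>\<omega>\<in>space (P n) - N1. A n \<omega>" "\<forall>\<omega>\<in>space (P n) - N2. B n \<omega>"
      using elim by blast
    have "measure (P n) (N1 \<union> N2) \<le> measure (P n) N1 + measure (P n) N2"
      using N by (intro measure_Un_le) auto
    with N show ?case by (intro bexI[of _ "N1 \<union> N2"]) auto
  qed
qed

lemma whp_mono:
  assumes "whp P A"
    and "\<forall>\<^sub>F n in sequentially. \<forall>\<omega>\<in>space (P n). A n \<omega> \<longrightarrow> B n \<omega>"
  shows "whp P B"
proof (rule whpI)
  fix \<alpha> :: real assume "\<alpha> > 0"
  with assms(1) have
    "\<forall>\<^sub>F n in sequentially. \<exists>N\<in>sets (P n). measure (P n) N \<le> \<alpha> \<and> (\<forall>\<omega>\<in>space (P n) - N. A n \<omega>)"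
    unfolding whp_def by blast
  with assms(2) show "\<forall>\<^sub>F n in sequentially. \<exists>N\<in>sets (P n).
               measure (P n) N \<le> \<alpha> \<and> (\<forall>\<omega>\<in>space (P n) - N. B n \<omega>)"
    by eventually_elim blast
qed

lemma whp_AE:
  assumes "\<And>n. AE \<omega> in P n. A n \<omega>"
  shows "whp P A"
proof (rule whpI, rule always_eventually, rule allI)
  fix \<alpha> :: real and n assume "\<alpha> > 0"
  from assms[of n] obtain N where
    "{\<omega> \<in> space (P n). \<not> A n \<omega>} \<subseteq> N" "emeasure (P n) N = 0" "N \<in> sets (P n)"
    by (rule AE_E)
  with \<open>\<alpha> > 0\<close> show "\<exists>N\<in>sets (P n). measure (P n) N \<le> \<alpha> \<and> (\<forall>\<omega>\<in>space (P n) - N. A n \<omega>)"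
    by (intro bexI[of _ N]) (auto simp: measure_def)
qed

text \<open>The set where \<open>A n\<close> fails may be non-measurable. Its \<open>measure\<close>
  is then 0 by default, so comparison with the measurable exceptional set gives the bound in either
  case.\<close>

lemma whp_measure_compl:
  assumes "\<And>n. prob_space (P n)" "whp P A" "\<alpha> > 0"
  shows "\<forall>\<^sub>F n in sequentially. measure (P n) {\<omega>\<in>space (P n). \<not> A n \<omega>} \<le> \<alpha>"
proof -
  have "\<forall>\<^sub>F n in sequentially. \<exists>N\<in>sets (P n). measure (P n) N \<le> \<alpha> \<and> (\<forall>\<omega>\<in>space (P n) - N. A n \<omega>)"
    using assms by (auto simp: whp_def)
  then show ?thesis
  proof eventually_elim
    case (elim n)
    interpret prob_space "P n" by (rule assms)
    from elim obtain N where N: "N \<in> sets (P n)" "measure (P n) N \<le> \<alpha>"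
        "\<forall>\<omega>\<in>space (P n) - N. A n \<omega>" by blast
    then have "measure (P n) {\<omega>\<in>space (P n). \<not> A n \<omega>} \<le> measure (P n) N"
      by (intro finite_measure_mono) auto
    with N show ?case by simp
  qed
qed


text \<open>Passing to the complement needs measurability: a non-measurable event of high inner
  probability would still get \<open>measure\<close> 0.\<close>

lemma whp_imp_measure_tendsto_1:
  assumes prob: "\<And>n. prob_space (P n)" and A: "whp P A"
    and meas: "\<And>n. {\<omega>\<in>space (P n). A n \<omega>} \<in> sets (P n)"
  shows "(\<lambda>n. measure (P n) {\<omega>\<in>space (P n). A n \<omega>}) \<longlonglongrightarrow> 1"
proof (rule tendstoI)
  fix e :: real assume "e > 0"
  then have "\<forall>\<^sub>F n in sequentially. measure (P n) {\<omega>\<in>space (P n). \<not> A n \<omega>} \<le> e/2"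
    by (intro whp_measure_compl[OF prob A]) simp
  then show "\<forall>\<^sub>F n in sequentially. dist (measure (P n) {\<omega>\<in>space (P n). A n \<omega>}) 1 < e"
  proof eventually_elim
    case (elim n)
    interpret prob_space "P n" by (rule prob)
    have "measure (P n) {\<omega>\<in>space (P n). \<not> A n \<omega>} = 1 - measure (P n) {\<omega>\<in>space (P n). A n \<omega>}"
      using meas by (rule prob_neg)
    with elim \<open>e > 0\<close> show ?case by (simp add: dist_real_def)
  qed
qed

lemma tends_in_prob_iff_whp:
  assumes prob: "\<And>n. prob_space (P n)" and meas: "\<And>n. Y n \<in> borel_measurable (P n)"
  shows "tends_in_prob P Y c \<longleftrightarrow> (\<forall>\<epsilon>>0. whp P (\<lambda>n \<omega>. \<bar>Y n \<omega> - c\<bar> \<le> \<epsilon>))"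
proof (intro iffI allI impI)
  fix \<epsilon> :: real assume Y: "tends_in_prob P Y c" and "\<epsilon> > 0"
  note meas[measurable]
  show "whp P (\<lambda>n \<omega>. \<bar>Y n \<omega> - c\<bar> \<le> \<epsilon>)"
  proof (rule whpI)
    fix \<alpha> :: real assume "\<alpha> > 0"
    have "(\<lambda>n. measure (P n) {\<omega> \<in> space (P n). \<bar>Y n \<omega> - c\<bar> > \<epsilon>}) \<longlonglongrightarrow> 0"
      using Y \<open>\<epsilon> > 0\<close> by (simp add: tends_in_prob_def)
    then have "\<forall>\<^sub>F n in sequentially. measure (P n) {\<omega> \<in> space (P n). \<bar>Y n \<omega> - c\<bar> > \<epsilon>} < \<alpha>"
      using \<open>\<alpha> > 0\<close> by (rule order_tendstoD)
    then show "\<forall>\<^sub>F n in sequentially. \<exists>N\<in>sets (P n).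
                 measure (P n) N \<le> \<alpha> \<and> (\<forall>\<omega>\<in>space (P n) - N. \<bar>Y n \<omega> - c\<bar> \<le> \<epsilon>)"
    proof eventually_elim
      case (elim n)
      then show ?case
        by (intro bexI[of _ "{\<omega> \<in> space (P n). \<bar>Y n \<omega> - c\<bar> > \<epsilon>}"]) auto
    qed
  qed
next
  assume *: "\<forall>\<epsilon>>0. whp P (\<lambda>n \<omega>. \<bar>Y n \<omega> - c\<bar> \<le> \<epsilon>)"
  show "tends_in_prob P Y c"
    unfolding tends_in_prob_def
  proof (intro allI impI tendstoI)
    fix \<epsilon> e :: real assume "\<epsilon> > 0" "e > 0"
    then have "\<forall>\<^sub>F n in sequentially. measure (P n) {\<omega>\<in>space (P n). \<not> \<bar>Y n \<omega> - c\<bar> \<le> \<epsilon>} \<le> e/2"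
      using * by (intro whp_measure_compl[OF prob]) auto
    then show "\<forall>\<^sub>F n in sequentially. dist (measure (P n) {\<omega>\<in>space (P n). \<bar>Y n \<omega> - c\<bar> > \<epsilon>}) 0 < e"
      by eventually_elim (use \<open>e > 0\<close> in \<open>simp add: not_le\<close>)
  qed
qed

subsection \<open>Markov's inequality at a random point\<close>

text \<open>By monotonicity in \<delta>, the events \<open>F \<delta> > \<eta>\<close> for \<delta>
  in \<open>U\<close> all lie in the union of those along an increasing sequence cofinal in
  \<open>U\<close>. Markov's inequality bounds each event of the sequence by \<epsilon> / \<eta>,
  and continuity from below carries the same bound to the union, so a single exceptional set serves
  every \<delta> in \<open>U\<close>.\<close>

lemma (in finite_measure) Markov_cofinal:
  fixes F :: "real \<Rightarrow> 'a \<Rightarrow> ennreal"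
  assumes mono: "\<And>\<omega>. mono (\<lambda>\<delta>. F \<delta> \<omega>)"
    and meas: "\<And>\<delta>. \<delta> \<in> U \<Longrightarrow> F \<delta> \<in> borel_measurable M"
    and down: "\<And>u v. v \<in> U \<Longrightarrow> 0 \<le> u \<Longrightarrow> u \<le> v \<Longrightarrow> u \<in> U" and nonneg: "U \<subseteq> {0..}"
    and bound: "\<And>\<delta>. \<delta> \<in> U \<Longrightarrow> (\<integral>\<^sup>+\<omega>. F \<delta> \<omega> \<partial>M) \<le> ennreal \<epsilon>"
    and "\<epsilon> \<ge> 0" "\<eta> > 0"
  shows "\<exists>N\<in>sets M. measure M N \<le> \<epsilon> / \<eta> \<and> (\<forall>\<omega>\<in>space M - N. \<forall>\<delta>\<in>U. F \<delta> \<omega> \<le> ennreal \<eta>)"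
proof (cases "U = {}")
  case True
  then show ?thesis using \<open>\<epsilon> \<ge> 0\<close> \<open>\<eta> > 0\<close> by (intro bexI[of _ "{}"]) auto
next
  case False
  \<comment> \<open>a countable set that is cofinal in \<open>U\<close>\<close>
  define C where "C = (U \<inter> \<rat>) \<union> {u\<in>U. \<forall>v\<in>U. v \<le> u}"
  have cof: "\<exists>c\<in>C. u \<le> c" if u: "u \<in> U" for u
  proof (cases "\<forall>v\<in>U. v \<le> u")
    case True
    with u show ?thesis by (auto simp: C_def)
  next
    case False
    then obtain v where v: "v \<in> U" "u < v" by (auto simp: not_le)
    then obtain q where q: "q \<in> \<rat>" "u < q" "q < v" using Rats_dense_in_real by blast
    then have "q \<in> U" using u nonneg v by (intro down[of v q]) auto
    with q show ?thesis unfolding C_def by (intro bexI[of _ q]) auto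
  qed
  have "countable {u\<in>U. \<forall>v\<in>U. v \<le> u}"
  proof (cases "\<exists>w\<in>U. \<forall>v\<in>U. v \<le> w")
    case True
    then obtain w where "w \<in> U" "\<forall>v\<in>U. v \<le> w" by blast
    then have "{u\<in>U. \<forall>v\<in>U. v \<le> u} \<subseteq> {w}" by (auto intro: antisym)
    then show ?thesis by (rule countable_subset) simp
  next
    case False
    then have empty: "{u\<in>U. \<forall>v\<in>U. v \<le> u} = {}" by blast
    show ?thesis unfolding empty by simp
  qed
  then have "countable C" by (auto simp: C_def countable_rat)
  moreover have "C \<noteq> {}" using False cof by blast
  ultimately obtain c :: "nat \<Rightarrow> real" where c: "range c = C"
    by (metis range_from_nat_into)
  \<comment> \<open>Running maxima turn the enumeration \<open>c\<close> into an increasing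
    sequence. A finite maximum is attained, so the sequence stays in \<open>U\<close>, and it
    dominates \<open>c\<close>, so it is still cofinal.\<close>
  define m where "m k = Max (c ` {..k})" for k
  have mU: "m k \<in> U" for k
  proof -
    have "m k \<in> c ` {..k}" unfolding m_def by (intro Max_in) auto
    then show ?thesis using c by (auto simp: C_def)
  qed
  have m_mono: "mono m"
    unfolding m_def by (intro monoI Max_mono) auto
  have cm: "c k \<le> m k" for k unfolding m_def by (intro Max_ge) auto
  define A where "A k = {\<omega>\<in>space M. F (m k) \<omega> > ennreal \<eta>}" for k
  have A: "A k \<in> sets M" for k using meas[OF mU] unfolding A_def by measurable
  have "incseq A"
    unfolding incseq_def A_def using m_mono mono by (auto simp: mono_def intro: less_le_trans)
  have le: "measure M (A k) \<le> \<epsilon> / \<eta>" for k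
  proof -
    have "ennreal \<eta> * emeasure M (A k) = (\<integral>\<^sup>+\<omega>. ennreal \<eta> * indicator (A k) \<omega> \<partial>M)"
      using A by (simp add: nn_integral_cmult_indicator)
    also have "\<dots> \<le> (\<integral>\<^sup>+\<omega>. F (m k) \<omega> \<partial>M)"
      by (intro nn_integral_mono) (auto simp: A_def indicator_def)
    also have "\<dots> \<le> ennreal \<epsilon>" by (rule bound[OF mU])
    finally have "ennreal (\<eta> * measure M (A k)) \<le> ennreal \<epsilon>"
      using \<open>\<eta> > 0\<close> by (simp add: emeasure_eq_measure ennreal_mult)
    then show ?thesis using \<open>\<eta> > 0\<close> \<open>\<epsilon> \<ge> 0\<close> by (simp add: field_simps)
  qed
  show ?thesis
  proof (intro bexI[of _ "\<Union>k. A k"] conjI ballI)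
    have "(\<lambda>k. measure M (A k)) \<longlonglongrightarrow> measure M (\<Union>k. A k)"
      using A \<open>incseq A\<close> by (intro finite_Lim_measure_incseq) auto
    then show "measure M (\<Union>k. A k) \<le> \<epsilon> / \<eta>"
      using le by (intro LIMSEQ_le_const2) auto
  next
    fix \<omega> \<delta> assume \<omega>: "\<omega> \<in> space M - (\<Union>k. A k)" and "\<delta> \<in> U"
    then obtain k where "\<delta> \<le> c k" using cof c by blast
    then have "F \<delta> \<omega> \<le> F (m k) \<omega>" using mono cm[of k] by (auto simp: mono_def intro: order_trans)
    also have "\<dots> \<le> ennreal \<eta>" using \<omega> by (auto simp: A_def not_less)
    finally show "F \<delta> \<omega> \<le> ennreal \<eta>" .
  qed (use A in auto)
qed

text \<open>The superlevel set is closed upwards, so its indicator is a monotone real function and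
  therefore Borel. This makes the event that a monotone mean exceeds a level at a random point
  measurable.\<close>

lemma mono_superlevel_borel:
  fixes g :: "real \<Rightarrow> 'b::linorder"
  assumes "mono g"
  shows "{d. c < g d} \<in> sets borel"
proof -
  have "mono (indicat_real {d. c < g d})"
    using assms by (auto simp: mono_def indicator_def intro: less_le_trans)
  then have "indicat_real {d. c < g d} \<in> borel_measurable borel" by (rule borel_measurable_mono)
  then show ?thesis by (simp add: borel_measurable_indicator_iff)
qed

text \<open>The mean is taken with \<open>D n \<omega>\<close> frozen, whereas the conclusion
  evaluates \<open>F\<close> with the same \<omega> in both places. The two are linked by a bound
  uniform over all \<delta> whose mean is at most \<epsilon>: with high probability
  \<open>D n \<omega>\<close> is one of these \<delta>, however it depends on the data.\<close>

lemma whp_Markov_at_random_point: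
  fixes F :: "nat \<Rightarrow> real \<Rightarrow> 'w \<Rightarrow> ennreal"
  assumes prob: "\<And>n. prob_space (P n)"
    and mono: "\<And>n \<omega>. mono (\<lambda>\<delta>. F n \<delta> \<omega>)"
    and meas: "\<And>n \<delta>. \<delta> \<ge> 0 \<Longrightarrow> F n \<delta> \<in> borel_measurable (P n)"
    and D: "\<And>n. D n \<in> borel_measurable (P n)" "\<And>n \<omega>. 0 \<le> D n \<omega>"
    and conv: "tends_in_prob_0 P (\<lambda>n \<omega>. \<integral>\<^sup>+\<omega>'. F n (D n \<omega>) \<omega>' \<partial>P n)"
    and "\<eta> > 0"
  shows "whp P (\<lambda>n \<omega>. F n (D n \<omega>) \<omega> \<le> ennreal \<eta>)"
proof (rule whpI)
  fix \<alpha> :: real assume "\<alpha> > 0"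
  \<comment> \<open>With this choice the Markov bound \<epsilon> / \<eta> equals \<alpha>/2, which
    leaves \<alpha>/2 for the event that the mean at \<open>D n \<omega>\<close> exceeds
    \<epsilon>.\<close>
  define \<epsilon> where "\<epsilon> = \<eta> * \<alpha> / 2"
  have "\<epsilon> > 0" using \<open>\<alpha> > 0\<close> \<open>\<eta> > 0\<close> by (simp add: \<epsilon>_def)
  define G where "G n \<delta> = (\<integral>\<^sup>+\<omega>. F n \<delta> \<omega> \<partial>P n)" for n \<delta>
  have G_mono: "mono (G n)" for n
    unfolding G_def using mono by (intro monoI nn_integral_mono) (auto simp: mono_def)
  have "(\<lambda>n. measure (P n) {\<omega> \<in> space (P n). G n (D n \<omega>) > ennreal \<epsilon>}) \<longlonglongrightarrow> 0"
    using conv \<open>\<epsilon> > 0\<close> by (simp add: tends_in_prob_0_def G_def)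
  moreover have "\<alpha>/2 > 0" using \<open>\<alpha> > 0\<close> by simp
  ultimately have "\<forall>\<^sub>F n in sequentially.
      measure (P n) {\<omega> \<in> space (P n). G n (D n \<omega>) > ennreal \<epsilon>} < \<alpha>/2"
    by (rule order_tendstoD)
  then show "\<forall>\<^sub>F n in sequentially. \<exists>N\<in>sets (P n).
      measure (P n) N \<le> \<alpha> \<and> (\<forall>\<omega>\<in>space (P n) - N. F n (D n \<omega>) \<omega> \<le> ennreal \<eta>)"
  proof eventually_elim
    case (elim n)
    interpret prob_space "P n" by (rule prob)
    define N1 where "N1 = {\<omega> \<in> space (P n). G n (D n \<omega>) > ennreal \<epsilon>}"
    have "D n -` {d. ennreal \<epsilon> < G n d} \<inter> space (P n) \<in> sets (P n)"
      using D(1) mono_superlevel_borel[OF G_mono] by (rule measurable_sets)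
    also have "D n -` {d. ennreal \<epsilon> < G n d} \<inter> space (P n) = N1" by (auto simp: N1_def)
    finally have N1: "N1 \<in> sets (P n)" .
    obtain N2 where N2: "N2 \<in> sets (P n)" "measure (P n) N2 \<le> \<epsilon> / \<eta>"
      "\<forall>\<omega>\<in>space (P n) - N2. \<forall>\<delta>\<in>{\<delta>. 0 \<le> \<delta> \<and> G n \<delta> \<le> ennreal \<epsilon>}. F n \<delta> \<omega> \<le> ennreal \<eta>"
    proof -
      have "\<exists>N\<in>sets (P n). measure (P n) N \<le> \<epsilon> / \<eta> \<and>
          (\<forall>\<omega>\<in>space (P n) - N. \<forall>\<delta>\<in>{\<delta>. 0 \<le> \<delta> \<and> G n \<delta> \<le> ennreal \<epsilon>}. F n \<delta> \<omega> \<le> ennreal \<eta>)"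
      proof (rule Markov_cofinal[OF mono])
        show "u \<in> {\<delta>. 0 \<le> \<delta> \<and> G n \<delta> \<le> ennreal \<epsilon>}"
          if "v \<in> {\<delta>. 0 \<le> \<delta> \<and> G n \<delta> \<le> ennreal \<epsilon>}" "0 \<le> u" "u \<le> v" for u v
          using that monoD[OF G_mono, of u v] by (auto intro: order_trans)
      qed (use meas \<open>\<epsilon> > 0\<close> \<open>\<eta> > 0\<close> in \<open>auto simp: G_def\<close>)
      with that show thesis by blast
    qed
    have "measure (P n) (N1 \<union> N2) \<le> measure (P n) N1 + measure (P n) N2"
      using N1 N2 by (intro measure_Un_le) auto
    also have "\<dots> \<le> \<alpha>/2 + \<epsilon> / \<eta>" using elim N2 unfolding N1_def by linarith
    also have "\<dots> = \<alpha>" using \<open>\<eta> > 0\<close> by (simp add: \<epsilon>_def)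
    finally show ?case
      using N1 N2 D(2) by (intro bexI[of _ "N1 \<union> N2"]) (auto simp: N1_def not_less)
  qed
qed

text \<open>A fixed radius \<delta> is chosen with asymptotically small mean. If
  \<open>D n \<omega>\<close> is at most \<delta>, Markov's inequality holds simultaneously on the
  whole interval up to \<delta>. If it is larger, the factor \<open>\<rho> n * D n \<omega>\<close>
  is eventually at least 1 / \<kappa>, and the scaled bound alone forces \<open>T\<close> below
  \<kappa>.\<close>

lemma whp_le_of_scaled:
  fixes T :: "nat \<Rightarrow> real \<Rightarrow> 'w \<Rightarrow> ennreal"
  assumes prob: "\<And>n. prob_space (P n)"
    and mono: "\<And>n \<omega>. mono (\<lambda>\<delta>. T n \<delta> \<omega>)"
    and meas: "\<And>n \<delta>. \<delta> \<ge> 0 \<Longrightarrow> T n \<delta> \<in> borel_measurable (P n)"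
    and D: "\<And>n \<omega>. 0 \<le> D n \<omega>"
    and small: "((\<lambda>\<delta>. limsup (\<lambda>n. \<integral>\<^sup>+\<omega>. T n \<delta> \<omega> \<partial>P n)) \<longlongrightarrow> 0) (at_right 0)"
    and \<rho>: "filterlim \<rho> at_top sequentially"
    and scaled: "whp P (\<lambda>n \<omega>. ennreal (\<rho> n * D n \<omega>) * T n (D n \<omega>) \<omega> \<le> 1)"
    and "\<kappa> > 0"
  shows "whp P (\<lambda>n \<omega>. T n (D n \<omega>) \<omega> \<le> ennreal \<kappa>)"
proof (rule whpI)
  fix \<alpha> :: real assume "\<alpha> > 0"
  define \<epsilon> where "\<epsilon> = \<kappa> * \<alpha> / 2"
  have "\<epsilon> > 0" using \<open>\<alpha> > 0\<close> \<open>\<kappa> > 0\<close> by (simp add: \<epsilon>_def)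
  define G where "G n \<delta> = (\<integral>\<^sup>+\<omega>. T n \<delta> \<omega> \<partial>P n)" for n \<delta>
  have G_mono: "mono (G n)" for n
    unfolding G_def using mono by (intro monoI nn_integral_mono) (auto simp: mono_def)
  have "\<forall>\<^sub>F \<delta> in at_right 0. limsup (\<lambda>n. G n \<delta>) < ennreal \<epsilon>"
    using small \<open>\<epsilon> > 0\<close> unfolding G_def by (intro order_tendstoD(2)) auto
  then obtain b where "b > 0" "\<And>\<delta>. 0 < \<delta> \<Longrightarrow> \<delta> < b \<Longrightarrow> limsup (\<lambda>n. G n \<delta>) < ennreal \<epsilon>"
    by (auto simp: eventually_at_right_field)
  then obtain \<delta> where \<delta>: "\<delta> > 0" "limsup (\<lambda>n. G n \<delta>) < ennreal \<epsilon>"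
    using dense[of 0 b] by blast
  have "\<alpha>/2 > 0" using \<open>\<alpha> > 0\<close> by simp
  have 1: "\<forall>\<^sub>F n in sequentially. G n \<delta> < ennreal \<epsilon>" using \<delta>(2) by (rule Limsup_lessD)
  \<comment> \<open>The threshold is such that \<open>D n \<omega> > \<delta>\<close> implies
    \<open>\<rho> n * D n \<omega> \<ge> 1 / \<kappa>\<close>.\<close>
  have 2: "\<forall>\<^sub>F n in sequentially. \<rho> n \<ge> 1 / (\<kappa> * \<delta>)"
    using \<rho> by (simp add: filterlim_at_top)
  have 3: "\<forall>\<^sub>F n in sequentially. \<exists>N\<in>sets (P n). measure (P n) N \<le> \<alpha>/2 \<and>
      (\<forall>\<omega>\<in>space (P n) - N. ennreal (\<rho> n * D n \<omega>) * T n (D n \<omega>) \<omega> \<le> 1)"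
    using scaled \<open>\<alpha>/2 > 0\<close> unfolding whp_def by blast
  from 1 2 3 show "\<forall>\<^sub>F n in sequentially. \<exists>N\<in>sets (P n).
      measure (P n) N \<le> \<alpha> \<and> (\<forall>\<omega>\<in>space (P n) - N. T n (D n \<omega>) \<omega> \<le> ennreal \<kappa>)"
  proof eventually_elim
    case (elim n)
    interpret prob_space "P n" by (rule prob)
    obtain N1 where N1: "N1 \<in> sets (P n)" "measure (P n) N1 \<le> \<alpha>/2"
        "\<And>\<omega>. \<omega> \<in> space (P n) - N1 \<Longrightarrow> ennreal (\<rho> n * D n \<omega>) * T n (D n \<omega>) \<omega> \<le> 1"
      using elim(3) by blast
    have "\<exists>N\<in>sets (P n). measure (P n) N \<le> \<epsilon> / \<kappa> \<and>
        (\<forall>\<omega>\<in>space (P n) - N. \<forall>d\<in>{0..\<delta>}. T n d \<omega> \<le> ennreal \<kappa>)"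
    proof (rule Markov_cofinal[OF mono])
      show "(\<integral>\<^sup>+\<omega>. T n d \<omega> \<partial>P n) \<le> ennreal \<epsilon>" if "d \<in> {0..\<delta>}" for d
        using elim(1) monoD[OF G_mono, of d \<delta> n] that unfolding G_def by auto
    qed (use meas \<open>\<epsilon> > 0\<close> \<open>\<kappa> > 0\<close> in auto)
    then obtain N2 where N2: "N2 \<in> sets (P n)" "measure (P n) N2 \<le> \<epsilon> / \<kappa>"
        "\<And>\<omega> d. \<omega> \<in> space (P n) - N2 \<Longrightarrow> d \<in> {0..\<delta>} \<Longrightarrow> T n d \<omega> \<le> ennreal \<kappa>"
      by blast
    have "measure (P n) (N1 \<union> N2) \<le> measure (P n) N1 + measure (P n) N2"
      using N1 N2 by (intro measure_Un_le) auto
    also have "\<dots> \<le> \<alpha>/2 + \<epsilon> / \<kappa>" using N1 N2 by linarith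
    also have "\<dots> = \<alpha>" using \<open>\<kappa> > 0\<close> by (simp add: \<epsilon>_def)
    finally have "measure (P n) (N1 \<union> N2) \<le> \<alpha>" .
    moreover have "T n (D n \<omega>) \<omega> \<le> ennreal \<kappa>" if \<omega>: "\<omega> \<in> space (P n) - (N1 \<union> N2)" for \<omega>
    proof (cases "D n \<omega> \<le> \<delta>")
      case True
      with N2(3)[of \<omega> "D n \<omega>"] \<omega> D show ?thesis by auto
    next
      case False
      have "1 / \<kappa> = 1 / (\<kappa> * \<delta>) * \<delta>" using \<delta>(1) by simp
      also have "\<dots> \<le> \<rho> n * D n \<omega>"
        using elim(2) False \<delta>(1) \<open>\<kappa> > 0\<close>
        by (intro mult_mono) (auto intro: order_trans[OF _ elim(2)])
      finally have "ennreal (1 / \<kappa>) \<le> ennreal (\<rho> n * D n \<omega>)" by (rule ennreal_leI)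
      then have "ennreal (1 / \<kappa>) * T n (D n \<omega>) \<omega> \<le> 1"
        using N1(3)[of \<omega>] \<omega> by (auto intro: order_trans[OF mult_right_mono])
      \<comment> \<open>Multiplying by \<kappa> cancels 1 / \<kappa> within \<open>ennreal\<close>,
        where finiteness of \<open>T\<close> does not have to be known beforehand.\<close>
      then have "ennreal \<kappa> * (ennreal (1 / \<kappa>) * T n (D n \<omega>) \<omega>) \<le> ennreal \<kappa> * 1"
        by (rule mult_left_mono) simp
      then show ?thesis using \<open>\<kappa> > 0\<close> by (simp flip: mult.assoc ennreal_mult)
    qed
    ultimately show ?case using N1(1) N2(1) by (intro bexI[of _ "N1 \<union> N2"]) auto
  qed
qed

subsection \<open>Weak convergence\<close>

text \<open>Convergence of the distribution functions at one continuity point far to the left and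
  one far to the right transfers the small tails of the limit law to all large n.\<close>

lemma bounded_in_prob_of_weak_conv:
  assumes prob: "\<And>n. prob_space (P n)" and meas: "\<And>n. Z n \<in> borel_measurable (P n)"
    and M: "real_distribution M" and conv: "weak_conv_m (\<lambda>n. distr (P n) borel (Z n)) M"
    and "\<alpha> > 0"
  shows "\<exists>K>0. \<forall>\<^sub>F n in sequentially. measure (P n) {\<omega>\<in>space (P n). \<bar>Z n \<omega>\<bar> > K} \<le> \<alpha>"
proof -
  interpret M: real_distribution M by (rule M)
  note meas[measurable]
  \<comment> \<open>Discontinuities are atoms, of which there are only countably many, so every
    nonempty open interval contains a continuity point.\<close>
  have cont: "\<exists>x\<in>{u<..<v}. isCont (cdf M) x" if "u < v" for u v :: real
  proof -
    have "uncountable ({u<..<v} - {x. measure M {x} > 0})"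
      using that M.countable_atoms by (simp add: uncountable_minus_countable uncountable_open_interval)
    then obtain x where "x \<in> {u<..<v}" "\<not> measure M {x} > 0"
      by (metis (no_types, lifting) DiffE all_not_in_conv countable_empty mem_Collect_eq)
    then have "isCont (cdf M) x" by (simp add: M.isCont_cdf zero_less_measure_iff)
    with \<open>x \<in> {u<..<v}\<close> show ?thesis by blast
  qed
  have "\<alpha>/4 > 0" using \<open>\<alpha> > 0\<close> by simp
  then have "\<forall>\<^sub>F x in at_bot. cdf M x < \<alpha>/4" by (rule order_tendstoD(2)[OF M.cdf_lim_at_bot])
  then obtain u where u: "\<And>x. x \<le> u \<Longrightarrow> cdf M x < \<alpha>/4"
    by (auto simp: eventually_at_bot_linorder)
  from \<open>\<alpha>/4 > 0\<close> have "1 - \<alpha>/4 < 1" by simp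
  then have "\<forall>\<^sub>F x in at_top. cdf M x > 1 - \<alpha>/4"
    by (rule order_tendstoD(1)[OF M.cdf_lim_at_top_prob])
  then obtain v where v: "\<And>x. x \<ge> v \<Longrightarrow> cdf M x > 1 - \<alpha>/4"
    by (auto simp: eventually_at_top_linorder)
  obtain a where a: "a \<in> {u - 1<..<u}" "isCont (cdf M) a" using cont[of "u - 1" u] by auto
  obtain b where b: "b \<in> {v<..<v + 1}" "isCont (cdf M) b" using cont[of v "v + 1"] by auto
  have "(\<lambda>n. cdf (distr (P n) borel (Z n)) a) \<longlonglongrightarrow> cdf M a"
       "(\<lambda>n. cdf (distr (P n) borel (Z n)) b) \<longlonglongrightarrow> cdf M b"
    using conv a b by (auto simp: weak_conv_m_def weak_conv_def)
  moreover have "cdf M a < \<alpha>/4" "cdf M b > 1 - \<alpha>/4" using u v a b by auto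
  ultimately have
    "\<forall>\<^sub>F n in sequentially. cdf (distr (P n) borel (Z n)) a < \<alpha>/4"
    "\<forall>\<^sub>F n in sequentially. cdf (distr (P n) borel (Z n)) b > 1 - \<alpha>/4"
    using order_tendstoD by blast+
  \<comment> \<open>The outer maximum with 1 makes the bound positive. Beyond it, \<open>Z n\<close>
    is either at most \<open>a\<close> or above \<open>b\<close>, and each of these has probability
    below \<alpha>/4.\<close>
  then have "\<forall>\<^sub>F n in sequentially.
      measure (P n) {\<omega>\<in>space (P n). \<bar>Z n \<omega>\<bar> > max 1 (max \<bar>a\<bar> \<bar>b\<bar>)} \<le> \<alpha>"
  proof eventually_elim
    case (elim n)
    interpret prob_space "P n" by (rule prob)
    let ?A = "{\<omega>\<in>space (P n). Z n \<omega> \<le> a}" and ?B = "{\<omega>\<in>space (P n). Z n \<omega> \<le> b}"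
    have cdf: "cdf (distr (P n) borel (Z n)) x = prob {\<omega>\<in>space (P n). Z n \<omega> \<le> x}" for x
      by (auto simp: cdf_def measure_distr intro!: arg_cong[where f=prob])
    have "prob {\<omega>\<in>space (P n). \<bar>Z n \<omega>\<bar> > max 1 (max \<bar>a\<bar> \<bar>b\<bar>)}
            \<le> prob (?A \<union> {\<omega>\<in>space (P n). \<not> Z n \<omega> \<le> b})"
      by (intro finite_measure_mono) auto
    also have "\<dots> \<le> prob ?A + prob {\<omega>\<in>space (P n). \<not> Z n \<omega> \<le> b}"
      by (intro measure_Un_le) auto
    also have "prob {\<omega>\<in>space (P n). \<not> Z n \<omega> \<le> b} = 1 - prob ?B"
      by (intro prob_neg) auto
    finally show ?case using elim \<open>\<alpha> > 0\<close> by (simp add: cdf)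
  qed
  then show ?thesis by (intro exI[of _ "max 1 (max \<bar>a\<bar> \<bar>b\<bar>)"]) auto
qed

text \<open>A vanishing factor times a factor bounded in probability: the bound \<open>K\<close> is
  fixed first, then \<open>W\<close> is made smaller than \<eta> / K.\<close>

lemma whp_mult_bounded_in_prob:
  assumes prob: "\<And>n. prob_space (P n)" and meas: "\<And>n. Z n \<in> borel_measurable (P n)"
    and bdd: "\<And>\<alpha>. \<alpha> > 0 \<Longrightarrow>
      \<exists>K>0. \<forall>\<^sub>F n in sequentially. measure (P n) {\<omega>\<in>space (P n). \<bar>Z n \<omega>\<bar> > K} \<le> \<alpha>"
    and W: "\<And>\<kappa>. \<kappa> > 0 \<Longrightarrow> whp P (\<lambda>n \<omega>. W n \<omega> \<le> \<kappa>)" and "\<eta> > (0::real)"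
  shows "whp P (\<lambda>n \<omega>. W n \<omega> * \<bar>Z n \<omega>\<bar> \<le> \<eta>)"
proof (rule whpI)
  fix \<alpha> :: real assume "\<alpha> > 0"
  then have "\<alpha>/2 > 0" by simp
  with bdd obtain K where "K > 0" and
    K: "\<forall>\<^sub>F n in sequentially. measure (P n) {\<omega>\<in>space (P n). \<bar>Z n \<omega>\<bar> > K} \<le> \<alpha>/2"
    by blast
  note meas[measurable]
  have "whp P (\<lambda>n \<omega>. W n \<omega> \<le> \<eta> / K)" using W \<open>K > 0\<close> \<open>\<eta> > 0\<close> by simp
  have "\<forall>\<^sub>F n in sequentially. \<exists>N\<in>sets (P n). measure (P n) N \<le> \<alpha>/2 \<and>
          (\<forall>\<omega>\<in>space (P n) - N. W n \<omega> \<le> \<eta> / K)"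
    using \<open>whp P (\<lambda>n \<omega>. W n \<omega> \<le> \<eta> / K)\<close> \<open>\<alpha>/2 > 0\<close> unfolding whp_def by blast
  with K show "\<forall>\<^sub>F n in sequentially. \<exists>N\<in>sets (P n). measure (P n) N \<le> \<alpha> \<and>
          (\<forall>\<omega>\<in>space (P n) - N. W n \<omega> * \<bar>Z n \<omega>\<bar> \<le> \<eta>)"
  proof eventually_elim
    case (elim n)
    interpret prob_space "P n" by (rule prob)
    let ?A = "{\<omega>\<in>space (P n). \<bar>Z n \<omega>\<bar> > K}"
    obtain N where N: "N \<in> sets (P n)" "measure (P n) N \<le> \<alpha>/2"
        "\<forall>\<omega>\<in>space (P n) - N. W n \<omega> \<le> \<eta> / K"
      using elim by blast
    have "measure (P n) (?A \<union> N) \<le> measure (P n) ?A + measure (P n) N"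
      using N by (intro measure_Un_le) auto
    then have "measure (P n) (?A \<union> N) \<le> \<alpha>" using elim(1) N(2) by simp
    moreover have "W n \<omega> * \<bar>Z n \<omega>\<bar> \<le> \<eta>" if "\<omega> \<in> space (P n) - (?A \<union> N)" for \<omega>
    proof -
      have "W n \<omega> * \<bar>Z n \<omega>\<bar> \<le> \<eta> / K * \<bar>Z n \<omega>\<bar>"
        using that N by (intro mult_right_mono) auto
      also have "\<dots> \<le> \<eta> / K * K"
        using that \<open>K > 0\<close> \<open>\<eta> > 0\<close> by (intro mult_left_mono) auto
      finally show ?thesis using \<open>K > 0\<close> by simp
    qed
    ultimately show ?case using N(1) by (intro bexI[of _ "?A \<union> N"]) auto
  qed
qed

lemma char_distr_eq:
  assumes "Z \<in> borel_measurable M"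
  shows "char (distr M borel Z) t = (CLINT \<omega>|M. iexp (t * Z \<omega>))"
  unfolding char_def using assms by (subst integral_distr) auto

lemma norm_iexp_diff_le: "cmod (iexp x - iexp y) \<le> \<bar>x - y\<bar>"
proof -
  have "iexp x - iexp y = iexp y * (iexp (x - y) - 1)"
    by (simp add: algebra_simps flip: exp_add)
  also have "cmod \<dots> = cmod (iexp (x - y) - 1)" by (simp add: norm_mult)
  also have "\<dots> \<le> \<bar>x - y\<bar>" using iexp_approx1[of "x - y" 0] by simp
  finally show ?thesis .
qed

text \<open>By Levy's continuity theorem it suffices to compare characteristic functions. The
  integrands differ by at most \<bar>t\<bar> \<epsilon> where \<open>Y n\<close> and
  \<open>Z n\<close> are \<epsilon>-close, and by at most 2 on the remaining event, whose
  probability vanishes.\<close>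

lemma Slutsky:
  assumes prob: "\<And>n. prob_space (P n)"
    and meas: "\<And>n. Y n \<in> borel_measurable (P n)" "\<And>n. Z n \<in> borel_measurable (P n)"
    and M: "real_distribution M" and conv: "weak_conv_m (\<lambda>n. distr (P n) borel (Z n)) M"
    and diff: "tends_in_prob P (\<lambda>n \<omega>. Y n \<omega> - Z n \<omega>) 0"
  shows "weak_conv_m (\<lambda>n. distr (P n) borel (Y n)) M"
proof (rule levy_continuity)
  show "real_distribution (distr (P n) borel (Y n))" for n
    using prob meas by (intro prob_space.real_distribution_distr)
  show "real_distribution M" by (rule M)
  note meas[measurable]
  fix t :: real
  have Z: "(\<lambda>n. char (distr (P n) borel (Z n)) t) \<longlonglongrightarrow> char M t"
    using prob meas M conv by (intro levy_continuity1 prob_space.real_distribution_distr)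
  have "(\<lambda>n. char (distr (P n) borel (Y n)) t - char (distr (P n) borel (Z n)) t) \<longlonglongrightarrow> 0"
  proof (rule tendstoI)
    fix e :: real assume "e > 0"
    \<comment> \<open>The 1 added to \<bar>t\<bar> avoids division by zero at t = 0. The Lipschitz
      part takes e/2 of the error, and twice a probability below e/4 takes the rest.\<close>
    define \<epsilon> where "\<epsilon> = e / (2 * (\<bar>t\<bar> + 1))"
    have "\<epsilon> > 0" using \<open>e > 0\<close> by (simp add: \<epsilon>_def)
    have "\<bar>t\<bar> * \<epsilon> \<le> (\<bar>t\<bar> + 1) * \<epsilon>" using \<open>\<epsilon> > 0\<close> by (intro mult_right_mono) auto
    also have "\<dots> = e / 2" by (simp add: \<epsilon>_def field_simps)
    finally have t\<epsilon>: "\<bar>t\<bar> * \<epsilon> \<le> e / 2" .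
    have "(\<lambda>n. measure (P n) {\<omega> \<in> space (P n). \<bar>Y n \<omega> - Z n \<omega>\<bar> > \<epsilon>}) \<longlonglongrightarrow> 0"
      using diff \<open>\<epsilon> > 0\<close> by (simp add: tends_in_prob_def)
    moreover have "e / 4 > 0" using \<open>e > 0\<close> by simp
    ultimately have
      "\<forall>\<^sub>F n in sequentially. measure (P n) {\<omega> \<in> space (P n). \<bar>Y n \<omega> - Z n \<omega>\<bar> > \<epsilon>} < e / 4"
      by (rule order_tendstoD)
    then show "\<forall>\<^sub>F n in sequentially.
      dist (char (distr (P n) borel (Y n)) t - char (distr (P n) borel (Z n)) t) 0 < e"
    proof eventually_elim
      case (elim n)
      interpret prob_space "P n" by (rule prob)
      define B where "B = {\<omega> \<in> space (P n). \<bar>Y n \<omega> - Z n \<omega>\<bar> > \<epsilon>}"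
      have [measurable]: "B \<in> sets (P n)" unfolding B_def by measurable
      have int: "integrable (P n) (\<lambda>\<omega>. iexp (t * f \<omega>))"
        if [measurable]: "f \<in> borel_measurable (P n)" for f
        by (intro integrable_const_bound[of _ 1]) auto
      have "cmod (char (distr (P n) borel (Y n)) t - char (distr (P n) borel (Z n)) t)
              = cmod (CLINT \<omega>|P n. iexp (t * Y n \<omega>) - iexp (t * Z n \<omega>))"
        using int by (subst Bochner_Integration.integral_diff) (auto simp: char_distr_eq)
      also have "\<dots> \<le> (LINT \<omega>|P n. cmod (iexp (t * Y n \<omega>) - iexp (t * Z n \<omega>)))"
        by (rule integral_norm_bound)
      also have "\<dots> \<le> (LINT \<omega>|P n. \<bar>t\<bar> * \<epsilon> + 2 * indicator B \<omega>)"
      proof (intro integral_mono)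
        show "integrable (P n) (\<lambda>\<omega>. cmod (iexp (t * Y n \<omega>) - iexp (t * Z n \<omega>)))"
          using int by (intro integrable_norm Bochner_Integration.integrable_diff) auto
        show "integrable (P n) (\<lambda>\<omega>. \<bar>t\<bar> * \<epsilon> + 2 * indicator B \<omega>)"
          by (intro Bochner_Integration.integrable_add integrable_const integrable_mult_right
              integrable_real_indicator) (auto simp: less_top[symmetric])
        fix \<omega> assume \<omega>: "\<omega> \<in> space (P n)"
        show "cmod (iexp (t * Y n \<omega>) - iexp (t * Z n \<omega>)) \<le> \<bar>t\<bar> * \<epsilon> + 2 * indicator B \<omega>"
        proof (cases "\<omega> \<in> B")
          case True
          have "cmod (iexp (t * Y n \<omega>) - iexp (t * Z n \<omega>)) \<le> 1 + 1"
            by (intro order_trans[OF norm_triangle_ineq4] add_mono) auto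
          moreover have "0 \<le> \<bar>t\<bar> * \<epsilon>" using \<open>\<epsilon> > 0\<close> by simp
          ultimately show ?thesis using True by simp
        next
          case False
          have "cmod (iexp (t * Y n \<omega>) - iexp (t * Z n \<omega>)) \<le> \<bar>t * Y n \<omega> - t * Z n \<omega>\<bar>"
            by (rule norm_iexp_diff_le)
          also have "\<dots> = \<bar>t\<bar> * \<bar>Y n \<omega> - Z n \<omega>\<bar>"
            by (simp add: abs_mult flip: right_diff_distrib)
          also have "\<dots> \<le> \<bar>t\<bar> * \<epsilon>" using False \<omega> by (intro mult_left_mono) (auto simp: B_def)
          finally show ?thesis using False by simp
        qed
      qed
      also have "\<dots> = \<bar>t\<bar> * \<epsilon> + 2 * prob B"
        by (subst Bochner_Integration.integral_add)
          (auto simp: prob_space less_top[symmetric] intro!: integrable_mult_right integrable_real_indicator)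
      also have "\<dots> < e" using t\<epsilon> elim unfolding B_def by linarith
      finally show ?case by (simp add: dist_norm)
    qed
  qed
  from tendsto_add[OF this Z] show "(\<lambda>n. char (distr (P n) borel (Y n)) t) \<longlonglongrightarrow> char M t"
    by simp
qed

text \<open>Negation replaces t by -t in the characteristic function, and that of the standard
  normal law is even.\<close>

lemma weak_conv_std_normal_uminus:
  assumes prob: "\<And>n. prob_space (P n)" and meas: "\<And>n. Z n \<in> borel_measurable (P n)"
    and conv: "weak_conv_m (\<lambda>n. distr (P n) borel (Z n)) std_normal_distribution"
  shows "weak_conv_m (\<lambda>n. distr (P n) borel (\<lambda>\<omega>. - Z n \<omega>)) std_normal_distribution"
proof (rule levy_continuity)
  note meas[measurable]
  show "real_distribution (distr (P n) borel (\<lambda>\<omega>. - Z n \<omega>))" for n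
    using prob by (intro prob_space.real_distribution_distr) simp_all
  show N: "real_distribution std_normal_distribution" by (rule real_dist_normal_dist)
  fix t :: real
  have "(\<lambda>n. char (distr (P n) borel (Z n)) (- t)) \<longlonglongrightarrow> char std_normal_distribution (- t)"
    using prob meas N conv by (intro levy_continuity1 prob_space.real_distribution_distr)
  then show "(\<lambda>n. char (distr (P n) borel (\<lambda>\<omega>. - Z n \<omega>)) t) \<longlonglongrightarrow> char std_normal_distribution t"
    by (simp add: char_distr_eq char_std_normal_distribution)
qed

subsection \<open>The linearization\<close>

lemma set_integral_linear_approx:
  fixes f :: "real \<Rightarrow> real"
  assumes int: "set_integrable lebesgue {a..b} f" and "a \<le> b"
    and bound: "\<And>t. t \<in> {a..b} \<Longrightarrow> \<bar>f t - c\<bar> \<le> K"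
  shows "\<bar>(LINT t:{a..b}|lebesgue. f t) - (b - a) * c\<bar> \<le> (b - a) * K"
proof -
  have const: "set_integrable lebesgue {a..b} (\<lambda>_. d)" for d :: real
    unfolding set_integrable_def by (intro integrable_scaleR_left integrable_real_indicator) (auto simp: emeasure_lborel_Icc_eq)
  have c_int: "(LINT t:{a..b}|lebesgue. d) = (b - a) * d" for d :: real
    using \<open>a \<le> b\<close> by (simp add: set_lebesgue_integral_def)
  have diff: "set_integrable lebesgue {a..b} (\<lambda>t. f t - c)"
    using int const by (rule set_integral_diff(1))
  have "(LINT t:{a..b}|lebesgue. f t) - (b - a) * c = (LINT t:{a..b}|lebesgue. f t - c)"
    using int const by (subst set_integral_diff(2)) (auto simp: c_int)
  also have "\<bar>\<dots>\<bar> \<le> (LINT t:{a..b}|lebesgue. \<bar>f t - c\<bar>)"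
    using set_integral_norm_bound[OF diff] by simp
  also have "\<dots> \<le> (LINT t:{a..b}|lebesgue. K)"
    using bound diff const by (intro set_integral_mono set_integrable_abs) auto
  finally show ?thesis by (simp add: c_int)
qed

text \<open>A larger radius enlarges the index set until the interval leaves \<Theta>, where the
  value jumps to the top element. For negative \<delta> the interval and the index set are empty and
  the value is 0, so monotonicity extends to the whole real line.\<close>

lemma tau_mono: "mono (\<lambda>\<delta>. tau \<Theta> \<theta> g \<delta> x)"
proof (rule monoI)
  fix \<delta>1 \<delta>2 :: real assume le: "\<delta>1 \<le> \<delta>2"
  show "tau \<Theta> \<theta> g \<delta>1 x \<le> tau \<Theta> \<theta> g \<delta>2 x"
  proof (cases "{\<theta> - \<delta>2..\<theta> + \<delta>2} \<subseteq> \<Theta>")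
    case True
    have "{\<theta> - \<delta>1..\<theta> + \<delta>1} \<subseteq> {\<theta> - \<delta>2..\<theta> + \<delta>2}" using le by auto
    with True have "{\<theta> - \<delta>1..\<theta> + \<delta>1} \<subseteq> \<Theta>" by blast
    with True le show ?thesis unfolding tau_def by (auto intro!: SUP_subset_mono)
  qed (simp add: tau_def)
qed

text \<open>Finiteness forces the symmetric interval around \<theta> with radius \<bar>s -
  \<theta>\<bar> into \<Theta>, so the integral formula applies between \<theta> and
  \<open>s\<close>. On that segment \<open>g\<close> stays within \<open>K\<close> of its value at
  \<theta>, and integrating gives the first-order remainder.\<close>

lemma tau_finite_imp_bounds:
  fixes s :: real
  assumes tau: "tau \<Theta> \<theta> g \<bar>s - \<theta>\<bar> x \<noteq> \<infinity>"
    and int: "\<And>t1 t2. t1 < t2 \<Longrightarrow> {t1..t2} \<subseteq> \<Theta> \<Longrightarrow>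
      set_integrable lebesgue {t1..t2} (\<lambda>t. g t x) \<and> m t2 x - m t1 x = (LINT t:{t1..t2}|lebesgue. g t x)"
  defines "K \<equiv> enn2real (tau \<Theta> \<theta> g \<bar>s - \<theta>\<bar> x)"
  shows "\<bar>g s x - g \<theta> x\<bar> \<le> K" and "\<bar>m s x - m \<theta> x - (s - \<theta>) * g \<theta> x\<bar> \<le> \<bar>s - \<theta>\<bar> * K"
    and "s \<in> \<Theta>"
proof -
  have sub: "{\<theta> - \<bar>s - \<theta>\<bar>..\<theta> + \<bar>s - \<theta>\<bar>} \<subseteq> \<Theta>" using tau by (auto simp: tau_def split: if_splits)
  then show "s \<in> \<Theta>" by (rule subsetD) auto
  have bound: "\<bar>g t x - g \<theta> x\<bar> \<le> K" if "\<bar>t - \<theta>\<bar> \<le> \<bar>s - \<theta>\<bar>" for t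
  proof -
    have "ennreal \<bar>g t x - g \<theta> x\<bar> \<le> tau \<Theta> \<theta> g \<bar>s - \<theta>\<bar> x"
      using sub that unfolding tau_def by (auto intro!: SUP_upper)
    also have "\<dots> = ennreal K" using tau by (simp add: K_def less_top)
    finally show ?thesis by (simp add: K_def)
  qed
  from bound[of s] show "\<bar>g s x - g \<theta> x\<bar> \<le> K" by simp
  consider "s = \<theta>" | "\<theta> < s" | "s < \<theta>" by linarith
  then show "\<bar>m s x - m \<theta> x - (s - \<theta>) * g \<theta> x\<bar> \<le> \<bar>s - \<theta>\<bar> * K"
  proof cases
    case 2
    then have "{\<theta>..s} \<subseteq> \<Theta>" using sub by (auto intro!: subsetD[OF sub])
    with int[OF 2] set_integral_linear_approx[of \<theta> s "\<lambda>t. g t x" "g \<theta> x" K] 2 bound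
    show ?thesis by (auto simp: abs_if)
  next
    case 3
    then have "{s..\<theta>} \<subseteq> \<Theta>" using sub by (auto intro!: subsetD[OF sub])
    with int[OF 3] set_integral_linear_approx[of s \<theta> "\<lambda>t. g t x" "g \<theta> x" K] 3 bound
    have "\<bar>(m \<theta> x - m s x) - (\<theta> - s) * g \<theta> x\<bar> \<le> (\<theta> - s) * K" by auto
    then show ?thesis using 3 by (simp add: abs_if algebra_simps split: if_splits)
  qed simp
qed

text \<open>The deterministic core, with r for the square root of I. The assumption \<open>W\<close>
  keeps \<open>a = A / J\<close> at least 1/2. The numerator consists of three terms of size at most
  \<eta>, and dividing by \<open>a\<close> at most doubles their sum, whence the factor 6.\<close>

lemma one_step_error_bound:
  fixes A B C E J h K r \<eta> :: real
  assumes "J \<noteq> 0" "r > 0"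
    and AB: "\<bar>A - B\<bar> \<le> K" and CE: "\<bar>C - E - h * B\<bar> \<le> \<bar>h\<bar> * K"
    and hK: "\<bar>J\<bar> / r * \<bar>h\<bar> * (K / \<bar>J\<bar>) \<le> \<eta>"
    and W: "\<bar>B / J - 1\<bar> + K / \<bar>J\<bar> \<le> 1/2"
    and WE: "(\<bar>B / J - 1\<bar> + K / \<bar>J\<bar>) * \<bar>E / r\<bar> \<le> \<eta>"
  shows "A \<noteq> 0" and "\<bar>J / r * (h - C / A) + 1 / r * E\<bar> \<le> 6 * \<eta>"
proof -
  define a where "a = A / J"
  have "\<bar>a - B / J\<bar> \<le> K / \<bar>J\<bar>"
    using AB \<open>J \<noteq> 0\<close> by (simp add: a_def abs_divide divide_right_mono flip: diff_divide_distrib)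
  then have a1: "\<bar>a - 1\<bar> \<le> \<bar>B / J - 1\<bar> + K / \<bar>J\<bar>" by linarith
  with W have a: "a \<ge> 1/2" by linarith
  then show "A \<noteq> 0" by (auto simp: a_def)
  have hK': "\<bar>h\<bar> * K / r \<le> \<eta>" using hK \<open>J \<noteq> 0\<close> by (simp add: field_simps)
  have "\<bar>h / r * (A - B)\<bar> \<le> \<bar>h\<bar> * K / r"
    using AB \<open>r > 0\<close> by (simp add: abs_mult divide_right_mono mult_left_mono)
  moreover have "\<bar>(C - E - h * B) / r\<bar> \<le> \<bar>h\<bar> * K / r"
    using CE \<open>r > 0\<close> by (simp add: divide_right_mono)
  moreover have "\<bar>(a - 1) * (E / r)\<bar> \<le> \<eta>"
    unfolding abs_mult by (rule order_trans[OF mult_right_mono[OF a1] WE]) simp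
  moreover have "\<bar>x - y + z\<bar> \<le> 3 * \<eta>"
    if "\<bar>x\<bar> \<le> \<bar>h\<bar> * K / r" "\<bar>y\<bar> \<le> \<bar>h\<bar> * K / r" "\<bar>z\<bar> \<le> \<eta>" for x y z :: real
    using that hK' by linarith
  ultimately have num: "\<bar>h / r * (A - B) - (C - E - h * B) / r + (a - 1) * (E / r)\<bar> \<le> 3 * \<eta>"
    by blast
  \<comment> \<open>Multiplied by \<open>a\<close>, the left side is (h A - C + a E) / r. Adding and
    subtracting h B and E splits it into the three terms estimated above.\<close>
  have "J / r * (h - C / A) + 1 / r * E
          = (h / r * (A - B) - (C - E - h * B) / r + (a - 1) * (E / r)) / a"
    using \<open>J \<noteq> 0\<close> \<open>r > 0\<close> \<open>A \<noteq> 0\<close> by (simp add: a_def field_simps)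
  also have "\<bar>\<dots>\<bar> = \<bar>h / r * (A - B) - (C - E - h * B) / r + (a - 1) * (E / r)\<bar> / a"
    using a by simp
  also have "\<dots> \<le> (3 * \<eta>) / a" using num a by (intro divide_right_mono) auto
  also have "\<dots> \<le> (3 * \<eta>) / (1/2)" using a num by (intro divide_left_mono) auto
  finally show "\<bar>J / r * (h - C / A) + 1 / r * E\<bar> \<le> 6 * \<eta>" by simp
qed

theorem mainTheorem1:
  fixes P :: "nat \<Rightarrow> 'w measure"
    and S :: "nat \<Rightarrow> 'a measure"
    and X :: "nat \<Rightarrow> nat \<Rightarrow> 'w \<Rightarrow> 'a"
    and \<Theta> :: "real set"
    and \<theta> :: real
    and M M' :: "nat \<Rightarrow> nat \<Rightarrow> real \<Rightarrow> 'a \<Rightarrow> real"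
    and T :: "nat \<Rightarrow> (nat \<Rightarrow> 'a) \<Rightarrow> real"
  assumes prob: "\<And>n. prob_space (P n)"
    and indep: "\<And>n. prob_space.indep_vars (P n) (\<lambda>_. S n) (X n) {1..n}"
    and Theta: "open \<Theta>" "\<theta> \<in> \<Theta>"
    \<comment> \<open>measurability of the quantities entering the statement\<close>
    and meas_T: "\<And>n. T n \<in> borel_measurable (PiM {1..n} (\<lambda>_. S n))"
    and meas_tau: "\<And>n i \<delta>. i \<in> {1..n} \<Longrightarrow> \<delta> \<ge> 0 \<Longrightarrow>
          (\<lambda>\<omega>. tau \<Theta> \<theta> (M' n i) \<delta> (X n i \<omega>)) \<in> borel_measurable (P n)"
    and meas_M: "\<And>n i. i \<in> {1..n} \<Longrightarrow>
          (\<lambda>\<omega>. M n i (estimate X T n \<omega>) (X n i \<omega>))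
            \<in> borel_measurable (restrict_space (P n) {\<omega>. estimate X T n \<omega> \<in> \<Theta>})"
    and meas_M': "\<And>n i. i \<in> {1..n} \<Longrightarrow>
          (\<lambda>\<omega>. M' n i (estimate X T n \<omega>) (X n i \<omega>))
            \<in> borel_measurable (restrict_space (P n) {\<omega>. estimate X T n \<omega> \<in> \<Theta>})"
    \<comment> \<open>(a)\<close>
    and a_int: "\<And>n i. i \<in> {1..n} \<Longrightarrow>
          AE \<omega> in P n. \<forall>t1 t2. t1 < t2 \<and> {t1..t2} \<subseteq> \<Theta> \<longrightarrow>
            set_integrable lebesgue {t1..t2} (\<lambda>t. M' n i t (X n i \<omega>)) \<and>
            M n i t2 (X n i \<omega>) - M n i t1 (X n i \<omega>) = (LINT t:{t1..t2}|lebesgue. M' n i t (X n i \<omega>))"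
    and a_mean: "\<And>n i. i \<in> {1..n} \<Longrightarrow> integrable (P n) (\<lambda>\<omega>. M n i \<theta> (X n i \<omega>))"
          "\<And>n i. i \<in> {1..n} \<Longrightarrow> (LINT \<omega>|P n. M n i \<theta> (X n i \<omega>)) = 0"
    and a_sq: "\<And>n i. i \<in> {1..n} \<Longrightarrow> integrable (P n) (\<lambda>\<omega>. (M n i \<theta> (X n i \<omega>))\<^sup>2)"
    and a_deriv: "\<And>n i. i \<in> {1..n} \<Longrightarrow> integrable (P n) (\<lambda>\<omega>. M' n i \<theta> (X n i \<omega>))"
    \<comment> \<open>(b)\<close>
    and b_pos: "\<forall>\<^sub>F n in sequentially. I_sum P X M \<theta> n > 0 \<and> J_sum P X M' \<theta> n \<noteq> 0"
    and b_inf: "filterlim (\<lambda>n. \<bar>J_sum P X M' \<theta> n\<bar> / sqrt (I_sum P X M \<theta> n)) at_top sequentially"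
    and b_lln: "tends_in_prob P
          (\<lambda>n \<omega>. (\<Sum>i=1..n. M' n i \<theta> (X n i \<omega>)) / J_sum P X M' \<theta> n) 1"
    and b_clt: "weak_conv_m
          (\<lambda>n. distr (P n) borel (\<lambda>\<omega>. (\<Sum>i=1..n. M n i \<theta> (X n i \<omega>)) / sqrt (I_sum P X M \<theta> n)))
          std_normal_distribution"
    \<comment> \<open>(c)\<close>
    and c: "((\<lambda>\<delta>. limsup (\<lambda>n. tau_bar P X \<Theta> M' \<theta> n \<delta>)) \<longlongrightarrow> 0) (at_right 0)"
    \<comment> \<open>(d)\<close>
    and d: "tends_in_prob_0 P
          (\<lambda>n \<omega>. ennreal (\<bar>J_sum P X M' \<theta> n\<bar> / sqrt (I_sum P X M \<theta> n) * \<bar>estimate X T n \<omega> - \<theta>\<bar>)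
                  * tau_bar P X \<Theta> M' \<theta> n \<bar>estimate X T n \<omega> - \<theta>\<bar>)"
  shows "(\<lambda>n. measure (P n) {\<omega> \<in> space (P n). one_step_defined \<Theta> X M' (estimate X T) n \<omega>}) \<longlonglongrightarrow> 1
    \<and> (\<forall>V. one_step_version P \<Theta> X M M' (estimate X T) V \<longrightarrow>
          tends_in_prob P
            (\<lambda>n \<omega>. J_sum P X M' \<theta> n / sqrt (I_sum P X M \<theta> n) * (V n \<omega> - \<theta>)
                    + 1 / sqrt (I_sum P X M \<theta> n) * (\<Sum>i=1..n. M n i \<theta> (X n i \<omega>))) 0
        \<and> weak_conv_m
            (\<lambda>n. distr (P n) borel (\<lambda>\<omega>. J_sum P X M' \<theta> n / sqrt (I_sum P X M \<theta> n) * (V n \<omega> - \<theta>)))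
            std_normal_distribution)"
proof -

  \<comment> \<open>Normalized sums and their measurability\<close>
  define J where "J = J_sum P X M' \<theta>"
  define r where "r n = sqrt (I_sum P X M \<theta> n)" for n
  define D where "D n \<omega> = \<bar>estimate X T n \<omega> - \<theta>\<bar>" for n \<omega>
  define Tn where "Tn n \<delta> \<omega> = (\<Sum>i=1..n. tau \<Theta> \<theta> (M' n i) \<delta> (X n i \<omega>)) / ennreal \<bar>J n\<bar>" for n \<delta> \<omega>
  define E where "E n \<omega> = (\<Sum>i=1..n. M n i \<theta> (X n i \<omega>))" for n \<omega>
  define B where "B n \<omega> = (\<Sum>i=1..n. M' n i \<theta> (X n i \<omega>))" for n \<omega>

  have r_nonneg: "r n \<ge> 0" for n
    unfolding r_def I_sum_def by (intro real_sqrt_ge_zero sum_nonneg integral_nonneg_AE) auto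
  have ev_pos: "\<forall>\<^sub>F n in sequentially. r n > 0 \<and> J n \<noteq> 0"
    using b_pos by eventually_elim (simp add: r_def J_def)

  have X_meas: "X n i \<in> P n \<rightarrow>\<^sub>M S n" if "i \<in> {1..n}" for n i
    using indep[of n] that unfolding prob_space.indep_vars_def[OF prob] by blast
  have est_meas[measurable]: "estimate X T n \<in> borel_measurable (P n)" for n
  proof -
    have "(\<lambda>\<omega>. \<lambda>i\<in>{1..n}. X n i \<omega>) \<in> P n \<rightarrow>\<^sub>M PiM {1..n} (\<lambda>_. S n)"
      using X_meas by (intro measurable_restrict)
    from measurable_compose[OF this meas_T] show ?thesis by (simp add: estimate_def[abs_def])
  qed
  have D_meas: "D n \<in> borel_measurable (P n)" for n unfolding D_def[abs_def] by measurable
  have D_nonneg: "0 \<le> D n \<omega>" for n \<omega> by (simp add: D_def)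
  have E_meas: "E n \<in> borel_measurable (P n)" for n
    unfolding E_def[abs_def] using a_mean(1) by (intro borel_measurable_sum) auto
  have B_meas: "B n \<in> borel_measurable (P n)" for n
    unfolding B_def[abs_def] using a_deriv by (intro borel_measurable_sum) auto
  have tau_sum_meas: "(\<lambda>\<omega>. \<Sum>i=1..n. tau \<Theta> \<theta> (M' n i) \<delta> (X n i \<omega>)) \<in> borel_measurable (P n)"
    if "\<delta> \<ge> 0" for n \<delta>
    using meas_tau that by (intro borel_measurable_sum) auto
  have Tn_meas: "Tn n \<delta> \<in> borel_measurable (P n)" if "\<delta> \<ge> 0" for n \<delta>
    unfolding Tn_def[abs_def] using tau_sum_meas[OF that] by measurable
  have Tn_mono: "mono (\<lambda>\<delta>. Tn n \<delta> \<omega>)" for n \<omega>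
    unfolding Tn_def using monoD[OF tau_mono] by (intro monoI divide_right_mono_ennreal sum_mono)
  \<comment> \<open>This identifies the deterministic function of (c) and (d) as the mean of
    \<open>Tn\<close> at a fixed radius.\<close>
  have Tn_int: "(\<integral>\<^sup>+\<omega>. Tn n \<delta> \<omega> \<partial>P n) = tau_bar P X \<Theta> M' \<theta> n \<delta>" if "\<delta> \<ge> 0" for n \<delta>
    unfolding Tn_def tau_bar_def J_def nn_integral_divide[OF tau_sum_meas[OF that]]
    using meas_tau that by (subst nn_integral_sum) auto

  \<comment> \<open>Oscillation of the derivatives at the random radius\<close>
  have scaled: "whp P (\<lambda>n \<omega>. ennreal (\<bar>J n\<bar> / r n * D n \<omega>) * Tn n (D n \<omega>) \<omega> \<le> ennreal \<eta>)"
    if "\<eta> > 0" for \<eta>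
  proof (rule whp_Markov_at_random_point
      [OF prob, where F="\<lambda>n \<delta> \<omega>. ennreal (\<bar>J n\<bar> / r n * \<delta>) * Tn n \<delta> \<omega>"])
    show "mono (\<lambda>\<delta>. ennreal (\<bar>J n\<bar> / r n * \<delta>) * Tn n \<delta> \<omega>)" for n \<omega>
      using monoD[OF Tn_mono] r_nonneg by (intro monoI mult_mono ennreal_leI mult_left_mono) auto
    show "(\<lambda>\<omega>. ennreal (\<bar>J n\<bar> / r n * \<delta>) * Tn n \<delta> \<omega>) \<in> borel_measurable (P n)"
      if "\<delta> \<ge> 0" for n \<delta>
      using Tn_meas[OF that] by measurable
    have "(\<integral>\<^sup>+\<omega>'. ennreal (\<bar>J n\<bar> / r n * D n \<omega>) * Tn n (D n \<omega>) \<omega>' \<partial>P n)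
        = ennreal (\<bar>J_sum P X M' \<theta> n\<bar> / sqrt (I_sum P X M \<theta> n) * \<bar>estimate X T n \<omega> - \<theta>\<bar>)
            * tau_bar P X \<Theta> M' \<theta> n \<bar>estimate X T n \<omega> - \<theta>\<bar>" for n \<omega>
      using Tn_meas[OF D_nonneg] Tn_int[OF D_nonneg]
      by (simp add: nn_integral_cmult D_def J_def r_def)
    with d show "tends_in_prob_0 P
        (\<lambda>n \<omega>. \<integral>\<^sup>+\<omega>'. ennreal (\<bar>J n\<bar> / r n * D n \<omega>) * Tn n (D n \<omega>) \<omega>' \<partial>P n)"
      by simp
  qed (use D_meas D_nonneg that in auto)

  have T_small: "whp P (\<lambda>n \<omega>. Tn n (D n \<omega>) \<omega> \<le> ennreal \<kappa>)" if "\<kappa> > 0" for \<kappa>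
  proof (rule whp_le_of_scaled[OF prob Tn_mono Tn_meas D_nonneg _ _ _ that])
    show "((\<lambda>\<delta>. limsup (\<lambda>n. \<integral>\<^sup>+\<omega>. Tn n \<delta> \<omega> \<partial>P n)) \<longlongrightarrow> 0) (at_right 0)"
    proof (rule Lim_transform_eventually[OF c])
      show "\<forall>\<^sub>F \<delta> in at_right 0. limsup (\<lambda>n. tau_bar P X \<Theta> M' \<theta> n \<delta>)
              = limsup (\<lambda>n. \<integral>\<^sup>+\<omega>. Tn n \<delta> \<omega> \<partial>P n)"
        using eventually_at_right_less[of "0::real"] by eventually_elim (simp add: Tn_int)
    qed
    show "filterlim (\<lambda>n. \<bar>J n\<bar> / r n) at_top sequentially" using b_inf by (simp add: J_def r_def)
    show "whp P (\<lambda>n \<omega>. ennreal (\<bar>J n\<bar> / r n * D n \<omega>) * Tn n (D n \<omega>) \<omega> \<le> 1)"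
      using scaled[of 1] by simp
  qed

  \<comment> \<open>Law of large numbers and normalized score\<close>
  have B_small: "whp P (\<lambda>n \<omega>. \<bar>B n \<omega> / J n - 1\<bar> \<le> \<kappa>)" if "\<kappa> > 0" for \<kappa>
  proof -
    have "tends_in_prob P (\<lambda>n \<omega>. B n \<omega> / J n) 1" using b_lln by (simp add: B_def J_def)
    moreover have "(\<lambda>\<omega>. B n \<omega> / J n) \<in> borel_measurable (P n)" for n using B_meas by measurable
    ultimately show ?thesis using tends_in_prob_iff_whp[of P "\<lambda>n \<omega>. B n \<omega> / J n" 1] prob that by blast
  qed

  \<comment> \<open>Since \<open>enn2real\<close> sends \<infinity> to 0, a bound on
    \<open>W\<close> does not show that \<open>Tn\<close> is finite. The proof of
    \<open>good\<close> therefore uses \<open>T_small\<close> alongside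
    \<open>W_small\<close>.\<close>
  define W where "W n \<omega> = \<bar>B n \<omega> / J n - 1\<bar> + enn2real (Tn n (D n \<omega>) \<omega>)" for n \<omega>
  have W_small: "whp P (\<lambda>n \<omega>. W n \<omega> \<le> \<kappa>)" if "\<kappa> > 0" for \<kappa>
  proof (rule whp_mono[OF whp_conj[OF prob B_small T_small]])
    show "\<kappa>/2 > 0" "\<kappa>/2 > 0" using that by auto
    show "\<forall>\<^sub>F n in sequentially. \<forall>\<omega>\<in>space (P n).
        \<bar>B n \<omega> / J n - 1\<bar> \<le> \<kappa>/2 \<and> Tn n (D n \<omega>) \<omega> \<le> ennreal (\<kappa>/2) \<longrightarrow> W n \<omega> \<le> \<kappa>"
    proof (intro always_eventually allI ballI impI)
      fix n \<omega> assume *: "\<bar>B n \<omega> / J n - 1\<bar> \<le> \<kappa>/2 \<and> Tn n (D n \<omega>) \<omega> \<le> ennreal (\<kappa>/2)"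
      then have "enn2real (Tn n (D n \<omega>) \<omega>) \<le> \<kappa>/2" using that by (intro enn2real_leI) auto
      with * show "W n \<omega> \<le> \<kappa>" by (simp add: W_def)
    qed
  qed

  have Z_meas: "(\<lambda>\<omega>. E n \<omega> / r n) \<in> borel_measurable (P n)" for n using E_meas by measurable
  have Z_conv: "weak_conv_m (\<lambda>n. distr (P n) borel (\<lambda>\<omega>. E n \<omega> / r n)) std_normal_distribution"
    using b_clt by (simp add: E_def r_def)
  have WZ_small: "whp P (\<lambda>n \<omega>. W n \<omega> * \<bar>E n \<omega> / r n\<bar> \<le> \<eta>)" if "\<eta> > 0" for \<eta>
    using bounded_in_prob_of_weak_conv[OF prob Z_meas real_dist_normal_dist Z_conv] W_small that
    by (rule whp_mult_bounded_in_prob[OF prob Z_meas])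

  \<comment> \<open>The null set is common to all intervals, so the random endpoint given by the
    estimator may be inserted later.\<close>
  have int_all: "whp P (\<lambda>n \<omega>. \<forall>i\<in>{1..n}. \<forall>t1 t2. t1 < t2 \<and> {t1..t2} \<subseteq> \<Theta> \<longrightarrow>
      set_integrable lebesgue {t1..t2} (\<lambda>t. M' n i t (X n i \<omega>)) \<and>
      M n i t2 (X n i \<omega>) - M n i t1 (X n i \<omega>) = (LINT t:{t1..t2}|lebesgue. M' n i t (X n i \<omega>)))"
    using a_int by (intro whp_AE AE_finite_allI) auto

  \<comment> \<open>Error bound on an event of high probability\<close>
  have good: "whp P (\<lambda>n \<omega>. one_step_defined \<Theta> X M' (estimate X T) n \<omega> \<and>
      \<bar>J n / r n * (one_step X M M' (estimate X T) n \<omega> - \<theta>) + 1 / r n * E n \<omega>\<bar> \<le> 6 * \<eta>)"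
    if "\<eta> > 0" for \<eta>
  proof (rule whp_mono[OF whp_conj[OF prob int_all whp_conj[OF prob scaled[OF that]
          whp_conj[OF prob T_small whp_conj[OF prob W_small WZ_small[OF that]]]]]])
    \<comment> \<open>The bound 1 on \<open>Tn\<close> serves to guarantee finiteness; the bound 1/2
      on \<open>W\<close> keeps the denominator of the one-step correction away from zero.\<close>
    show "(1::real) > 0" "(1/2::real) > 0" by auto
    show "\<forall>\<^sub>F n in sequentially. \<forall>\<omega>\<in>space (P n).
        (\<forall>i\<in>{1..n}. \<forall>t1 t2. t1 < t2 \<and> {t1..t2} \<subseteq> \<Theta> \<longrightarrow>
          set_integrable lebesgue {t1..t2} (\<lambda>t. M' n i t (X n i \<omega>)) \<and>
          M n i t2 (X n i \<omega>) - M n i t1 (X n i \<omega>) = (LINT t:{t1..t2}|lebesgue. M' n i t (X n i \<omega>))) \<and>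
        ennreal (\<bar>J n\<bar> / r n * D n \<omega>) * Tn n (D n \<omega>) \<omega> \<le> ennreal \<eta> \<and>
        Tn n (D n \<omega>) \<omega> \<le> ennreal 1 \<and> W n \<omega> \<le> 1/2 \<and> W n \<omega> * \<bar>E n \<omega> / r n\<bar> \<le> \<eta> \<longrightarrow>
        one_step_defined \<Theta> X M' (estimate X T) n \<omega> \<and>
        \<bar>J n / r n * (one_step X M M' (estimate X T) n \<omega> - \<theta>) + 1 / r n * E n \<omega>\<bar> \<le> 6 * \<eta>"
      \<comment> \<open>For n > 0 there is an index i, and finiteness of its \<tau>-term is what
        places the estimator in \<Theta>.\<close>
      using ev_pos eventually_gt_at_top[of 0]
    proof eventually_elim
      case (elim n)
      show ?case
      proof (intro ballI impI, elim conjE)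
        fix \<omega>
        assume int: "\<forall>i\<in>{1..n}. \<forall>t1 t2. t1 < t2 \<and> {t1..t2} \<subseteq> \<Theta> \<longrightarrow>
            set_integrable lebesgue {t1..t2} (\<lambda>t. M' n i t (X n i \<omega>)) \<and>
            M n i t2 (X n i \<omega>) - M n i t1 (X n i \<omega>) = (LINT t:{t1..t2}|lebesgue. M' n i t (X n i \<omega>))"
          and sc: "ennreal (\<bar>J n\<bar> / r n * D n \<omega>) * Tn n (D n \<omega>) \<omega> \<le> ennreal \<eta>"
          and T1: "Tn n (D n \<omega>) \<omega> \<le> ennreal 1"
          and W: "W n \<omega> \<le> 1/2" and WZ: "W n \<omega> * \<bar>E n \<omega> / r n\<bar> \<le> \<eta>"
        let ?s = "estimate X T n \<omega>"
        define k where "k i = enn2real (tau \<Theta> \<theta> (M' n i) \<bar>?s - \<theta>\<bar> (X n i \<omega>))" for i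
        define K where "K = (\<Sum>i=1..n. k i)"
        \<comment> \<open>An infinite sum divided by the finite \<bar>J\<bar> would stay infinite,
          contradicting \<open>T1\<close>. Hence every summand is finite, and the rest can be
          computed with reals.\<close>
        have "(\<Sum>i=1..n. tau \<Theta> \<theta> (M' n i) (D n \<omega>) (X n i \<omega>)) \<noteq> \<infinity>"
        proof
          assume top: "(\<Sum>i=1..n. tau \<Theta> \<theta> (M' n i) (D n \<omega>) (X n i \<omega>)) = \<infinity>"
          show False using T1 unfolding Tn_def top by (simp add: ennreal_top_divide top_unique)
        qed
        then have fin: "tau \<Theta> \<theta> (M' n i) \<bar>?s - \<theta>\<bar> (X n i \<omega>) \<noteq> \<infinity>" if "i \<in> {1..n}" for i
          using that by (auto simp: D_def)
        have "(\<Sum>i=1..n. tau \<Theta> \<theta> (M' n i) (D n \<omega>) (X n i \<omega>)) = (\<Sum>i=1..n. ennreal (k i))"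
          using fin by (intro sum.cong) (auto simp: k_def D_def less_top)
        also have "\<dots> = ennreal K" unfolding K_def by (intro sum_ennreal) (simp add: k_def)
        finally have T_eq: "Tn n (D n \<omega>) \<omega> = ennreal (K / \<bar>J n\<bar>)"
          using elim by (simp add: Tn_def divide_ennreal K_def k_def sum_nonneg)
        have K: "K / \<bar>J n\<bar> \<ge> 0" by (simp add: K_def k_def sum_nonneg)
        have W_eq: "W n \<omega> = \<bar>B n \<omega> / J n - 1\<bar> + K / \<bar>J n\<bar>" using K by (simp add: W_def T_eq)
        have sc': "\<bar>J n\<bar> / r n * \<bar>?s - \<theta>\<bar> * (K / \<bar>J n\<bar>) \<le> \<eta>"
        proof -
          have "\<bar>J n\<bar> / r n * D n \<omega> \<ge> 0" using r_nonneg[of n] D_nonneg[of n \<omega>] by simp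
          then have "ennreal (\<bar>J n\<bar> / r n * D n \<omega> * (K / \<bar>J n\<bar>)) \<le> ennreal \<eta>"
            using sc K by (simp only: T_eq ennreal_mult)
          then show ?thesis using \<open>\<eta> > 0\<close> unfolding D_def by (subst (asm) ennreal_le_iff) auto
        qed
        define A where "A = (\<Sum>i=1..n. M' n i ?s (X n i \<omega>))"
        define C where "C = (\<Sum>i=1..n. M n i ?s (X n i \<omega>))"
        have bounds: "\<bar>M' n i ?s (X n i \<omega>) - M' n i \<theta> (X n i \<omega>)\<bar> \<le> k i"
          "\<bar>M n i ?s (X n i \<omega>) - M n i \<theta> (X n i \<omega>) - (?s - \<theta>) * M' n i \<theta> (X n i \<omega>)\<bar>
             \<le> \<bar>?s - \<theta>\<bar> * k i"
          "?s \<in> \<Theta>" if "i \<in> {1..n}" for i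
          using tau_finite_imp_bounds[OF fin[OF that], where m="M n i"] int that unfolding k_def by auto
        have "A - B n \<omega> = (\<Sum>i=1..n. M' n i ?s (X n i \<omega>) - M' n i \<theta> (X n i \<omega>))"
          by (simp add: A_def B_def sum_subtractf)
        also have "\<bar>\<dots>\<bar> \<le> K"
          unfolding K_def using bounds(1) by (intro order_trans[OF sum_abs] sum_mono)
        finally have AB: "\<bar>A - B n \<omega>\<bar> \<le> K" .
        have "C - E n \<omega> - (?s - \<theta>) * B n \<omega>
            = (\<Sum>i=1..n. M n i ?s (X n i \<omega>) - M n i \<theta> (X n i \<omega>) - (?s - \<theta>) * M' n i \<theta> (X n i \<omega>))"
          by (simp add: C_def E_def B_def sum_subtractf sum_distrib_left)
        also have "\<bar>\<dots>\<bar> \<le> \<bar>?s - \<theta>\<bar> * K"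
          unfolding K_def sum_distrib_left using bounds(2)
          by (intro order_trans[OF sum_abs] sum_mono)
        finally have CE: "\<bar>C - E n \<omega> - (?s - \<theta>) * B n \<omega>\<bar> \<le> \<bar>?s - \<theta>\<bar> * K" .
        from elim have "J n \<noteq> 0" "r n > 0" by auto
        note bnd = one_step_error_bound[OF this AB CE sc' W[unfolded W_eq] WZ[unfolded W_eq]]
        have "?s \<in> \<Theta>" using bounds(3)[of n] elim by simp
        with bnd(1) have "one_step_defined \<Theta> X M' (estimate X T) n \<omega>"
          by (simp add: one_step_defined_def A_def)
        moreover have "one_step X M M' (estimate X T) n \<omega> - \<theta> = (?s - \<theta>) - C / A"
          by (simp add: one_step_def A_def C_def)
        ultimately show "one_step_defined \<Theta> X M' (estimate X T) n \<omega> \<and>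
          \<bar>J n / r n * (one_step X M M' (estimate X T) n \<omega> - \<theta>) + 1 / r n * E n \<omega>\<bar> \<le> 6 * \<eta>"
          using bnd(2) by (simp only:)
      qed
    qed
  qed

  \<comment> \<open>Definedness, linearization and asymptotic normality\<close>
  have defined_meas: "{\<omega> \<in> space (P n). one_step_defined \<Theta> X M' (estimate X T) n \<omega>} \<in> sets (P n)" for n
  proof -
    let ?R = "restrict_space (P n) {\<omega>. estimate X T n \<omega> \<in> \<Theta>}"
    have \<Theta>_meas: "{\<omega>. estimate X T n \<omega> \<in> \<Theta>} \<inter> space (P n) \<in> sets (P n)"
      using measurable_sets[OF est_meas borel_open[OF Theta(1)], of n] by (simp add: vimage_def)
    \<comment> \<open>The derivative sum is known to be measurable only where the estimator lies in
      \<Theta>, so the argument runs in the restricted space. The definedness event lies inside that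
      measurable set.\<close>
    have "(\<lambda>\<omega>. \<Sum>i=1..n. M' n i (estimate X T n \<omega>) (X n i \<omega>)) \<in> borel_measurable ?R"
      using meas_M' by (intro borel_measurable_sum)
    then have "{\<omega> \<in> space ?R. (\<Sum>i=1..n. M' n i (estimate X T n \<omega>) (X n i \<omega>)) \<noteq> 0} \<in> sets ?R"
      by measurable
    also have "{\<omega> \<in> space ?R. (\<Sum>i=1..n. M' n i (estimate X T n \<omega>) (X n i \<omega>)) \<noteq> 0}
        = {\<omega> \<in> space (P n). one_step_defined \<Theta> X M' (estimate X T) n \<omega>}"
      by (auto simp: space_restrict_space one_step_defined_def)
    finally show ?thesis using \<Theta>_meas by (simp add: sets_restrict_space_iff)
  qed

  have "(\<lambda>n. measure (P n) {\<omega> \<in> space (P n). one_step_defined \<Theta> X M' (estimate X T) n \<omega>}) \<longlonglongrightarrow> 1"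
    using prob whp_mono[OF good[of 1]] defined_meas
    by (intro whp_imp_measure_tendsto_1) auto
  moreover have "tends_in_prob P (\<lambda>n \<omega>. J n / r n * (V n \<omega> - \<theta>) + 1 / r n * E n \<omega>) 0 \<and>
      weak_conv_m (\<lambda>n. distr (P n) borel (\<lambda>\<omega>. J n / r n * (V n \<omega> - \<theta>))) std_normal_distribution"
    if V: "one_step_version P \<Theta> X M M' (estimate X T) V" for V
  proof -
    have [measurable]: "V n \<in> borel_measurable (P n)" for n
      using V by (simp add: one_step_version_def)
    note E_meas[measurable]
    have \<Delta>: "tends_in_prob P (\<lambda>n \<omega>. J n / r n * (V n \<omega> - \<theta>) + 1 / r n * E n \<omega>) 0"
    proof (subst tends_in_prob_iff_whp[OF prob], measurable, intro allI impI)
      fix \<epsilon> :: real assume "\<epsilon> > 0"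
      \<comment> \<open>On the event from \<open>good\<close> the one-step estimator is defined, so
        \<open>V\<close> coincides with it there and inherits the bound 6 (\<epsilon>/6) =
        \<epsilon>; the values of \<open>V\<close> elsewhere do not matter.\<close>
      then have "\<epsilon> / 6 > 0" by simp
      from good[OF this]
      show "whp P (\<lambda>n \<omega>. \<bar>J n / r n * (V n \<omega> - \<theta>) + 1 / r n * E n \<omega> - 0\<bar> \<le> \<epsilon>)"
        by (rule whp_mono) (use V in \<open>auto simp: one_step_version_def\<close>)
    qed
    have "weak_conv_m (\<lambda>n. distr (P n) borel (\<lambda>\<omega>. J n / r n * (V n \<omega> - \<theta>))) std_normal_distribution"
    \<comment> \<open>The comparison sequence is minus the normalized score, whose limit is again
      standard normal by symmetry; the difference from it is the error term just shown to
      vanish.\<close>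
    proof (rule Slutsky[OF prob _ _ real_dist_normal_dist])
      show "weak_conv_m (\<lambda>n. distr (P n) borel (\<lambda>\<omega>. - (E n \<omega> / r n))) std_normal_distribution"
        by (rule weak_conv_std_normal_uminus[OF prob Z_meas Z_conv])
      show "tends_in_prob P (\<lambda>n \<omega>. J n / r n * (V n \<omega> - \<theta>) - - (E n \<omega> / r n)) 0"
        using \<Delta> by simp
    qed measurable
    with \<Delta> show ?thesis by blast
  qed
  ultimately show ?thesis unfolding J_def r_def E_def by blast
qed

end
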